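(* Let $k\ge1$ and let $\mathbf{n}=(n_1,\dots,n_k)$ and $\mathbf{a}=(a_1,\dots,a_k)$ be $k$-tuples of positive integers. Then $T(\mathbf{n};\mathbf{a};2)$ is true with exactly the following exceptions (up to simultaneous permutation of the entries of $\mathbf{n}$ and $\mathbf{a}$), in which it is false: \begin{itemize} \item $k=1$, $n_1\ge2$ and $\mathbf{a}=2$; \item $k=2$, $\mathbf{n}=(n_1,n_2)$ with $2\le n_1\le n_2$ and $\mathbf{a}=(1,1)$. \end{itemize}
   Context: We work over $\mathbb{C}$. For $k$-tuples $\mathbf{n},\mathbf{a}$ of positive integers, $\mathbb{P}^{\mathbf{n}}=\prod_{i=1}^k\mathbb{P}^{n_i}$ and $N=\prod_{i=1}^k\binom{n_i+a_i}{a_i}=\dim H^0(\mathbb{P}^{\mathbf{n}},\mathcal{O}(\mathbf{a}))$. For a zero-dimensional subscheme $Z\subset\mathbb{P}^{\mathbf{n}}$ put $h_{\mathbb{P}^{\mathbf{n}}}(Z,\mathbf{a})=\dim H^0(\mathcal{O}(\mathbf{a}))-\dim H^0(\mathcal{I}_Z(\mathbf{a}))$. A double point $p^2$ is the subscheme with ideal sheaf $\mathcal{I}_p^2$. The statement $T(\mathbf{n};\mathbf{a};s)$ is true if, for $Z$ a collection of $s$ general double points of $\mathbb{P}^{\mathbf{n}}$, $h_{\mathbb{P}^{\mathbf{n}}}(Z,\mathbf{a})=\min\{s(1+\sum_{i=1}^k n_i),\ N\}$; otherwise it is false. Equivalently (Terracini's lemma), $T(\mathbf{n};\mathbf{a};s)$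 is true iff the $s$-th secant variety of the Segre-Veronese variety $X_{\mathbf{n},\mathbf{a}}\subset\mathbb{P}^{N-1}$ ($\mathbb{P}^{\mathbf{n}}$ embedded by $\mathcal{O}(\mathbf{a})$) has the expected dimension $\min\{N-1,s(1+\sum_i n_i)-1\}$. *)

theory Defs
  imports Complex_Main "HOL-Library.Poly_Mapping" "HOL-Combinatorics.Permutations"
begin

section \<open>Complex polynomials in several variables\<close>

type_synonym 'v cpoly = "('v \<Rightarrow>\<^sub>0 nat) \<Rightarrow>\<^sub>0 complex"

definition scale_poly :: "complex \<Rightarrow> 'v cpoly \<Rightarrow> 'v cpoly" where
  "scale_poly c F = Poly_Mapping.single 0 c * F"

interpretation cpoly: vector_space "scale_poly :: complex \<Rightarrow> 'v cpoly \<Rightarrow> 'v cpoly"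
  by standard
    (simp_all add: scale_poly_def algebra_simps single_add mult_single flip: mult.assoc)

definition eval_poly :: "'v cpoly \<Rightarrow> ('v \<Rightarrow> complex) \<Rightarrow> complex" where
  "eval_poly F x =
    (\<Sum>m\<in>Poly_Mapping.keys F. Poly_Mapping.lookup F m *
       (\<Prod>v\<in>Poly_Mapping.keys m. x v ^ Poly_Mapping.lookup m v))"


section \<open>Multiprojective spaces\<close>

text \<open>
  The product of the projective spaces \<open>P^(n i)\<close>, \<open>i \<in> I\<close>, for a finite index set \<open>I\<close>.
  The variable \<open>(i, j)\<close> with \<open>i \<in> I\<close> and \<open>j \<le> n i\<close> is the \<open>j\<close>-th homogeneous coordinate
  on the \<open>i\<close>-th factor. A point is given by (a choice of) its homogeneous coordinates;
  whether a multihomogeneous polynomial vanishes at it does not depend on that choice, and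
  values of \<open>p\<close> at pairs that are not variables are never used.
\<close>

definition mvars :: "'i set \<Rightarrow> ('i \<Rightarrow> nat) \<Rightarrow> ('i \<times> nat) set" where
  "mvars I n = (SIGMA i:I. {..n i})"

definition points :: "'i set \<Rightarrow> ('i \<Rightarrow> nat) \<Rightarrow> ('i \<times> nat \<Rightarrow> complex) set" where
  "points I n = {p. \<forall>i\<in>I. \<exists>j\<le>n i. p (i, j) \<noteq> 0}"

definition coord_ring :: "'i set \<Rightarrow> ('i \<Rightarrow> nat) \<Rightarrow> ('i \<times> nat) cpoly set" where
  "coord_ring I n = {F. \<forall>m\<in>Poly_Mapping.keys F. Poly_Mapping.keys m \<subseteq> mvars I n}"

text \<open>The graded piece of multidegree \<open>d\<close>, that is, the space of global sections of \<open>O(d)\<close>.\<close>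

definition forms :: "'i set \<Rightarrow> ('i \<Rightarrow> nat) \<Rightarrow> ('i \<Rightarrow> nat) \<Rightarrow> ('i \<times> nat) cpoly set" where
  "forms I n d = {F \<in> coord_ring I n.
     \<forall>m\<in>Poly_Mapping.keys F. \<forall>i\<in>I. (\<Sum>j\<le>n i. Poly_Mapping.lookup m (i, j)) = d i}"

definition zariski_open :: "'i set \<Rightarrow> ('i \<Rightarrow> nat) \<Rightarrow> ('i \<times> nat \<Rightarrow> complex) set \<Rightarrow> bool" where
  "zariski_open I n U \<longleftrightarrow>
    (\<exists>E \<subseteq> (\<Union>d. forms I n d). U = {p \<in> points I n. \<exists>F\<in>E. eval_poly F p \<noteq> 0})"


section \<open>Ideals, ideal sheaves and double points\<close>

definition ideal_gen ::
    "'i set \<Rightarrow> ('i \<Rightarrow> nat) \<Rightarrow> ('i \<times> nat) cpoly set \<Rightarrow> ('i \<times> nat) cpoly set" where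
  "ideal_gen I n G =
    {(\<Sum>g\<in>A. c g * g) | A c. finite A \<and> A \<subseteq> G \<and> (\<forall>g\<in>A. c g \<in> coord_ring I n)}"

definition ideal_square ::
    "'i set \<Rightarrow> ('i \<Rightarrow> nat) \<Rightarrow> ('i \<times> nat) cpoly set \<Rightarrow> ('i \<times> nat) cpoly set" where
  "ideal_square I n J = ideal_gen I n {f * g | f g. f \<in> J \<and> g \<in> J}"

definition point_ideal ::
    "'i set \<Rightarrow> ('i \<Rightarrow> nat) \<Rightarrow> ('i \<times> nat \<Rightarrow> complex) \<Rightarrow> ('i \<times> nat) cpoly set" where
  "point_ideal I n p = ideal_gen I n {F \<in> (\<Union>d. forms I n d). eval_poly F p = 0}"

text \<open>
  A closed subscheme is given by a multihomogeneous ideal \<open>J\<close> whose associated sheaf is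
  the ideal sheaf. The following is the space of global sections of that sheaf twisted by
  \<open>O(a)\<close>: a form \<open>F\<close> of multidegree \<open>a\<close> belongs to it iff its germ at every point \<open>q\<close> lies
  in the stalk, i.e. in the homogeneous localization of \<open>J\<close> at \<open>q\<close>. No saturation of \<open>J\<close>
  is assumed.
\<close>

definition ideal_sections ::
    "'i set \<Rightarrow> ('i \<Rightarrow> nat) \<Rightarrow> ('i \<times> nat) cpoly set \<Rightarrow> ('i \<Rightarrow> nat) \<Rightarrow> ('i \<times> nat) cpoly set" where
  "ideal_sections I n J a = {F \<in> forms I n a.
     \<forall>q\<in>points I n. \<exists>H \<in> (\<Union>d. forms I n d). eval_poly H q \<noteq> 0 \<and> H * F \<in> J}"

text \<open>
  The subtraction does not truncate: the second space is a subspace of the first, which is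
  finite-dimensional for finite \<open>I\<close>.
\<close>

definition hilb ::
    "'i set \<Rightarrow> ('i \<Rightarrow> nat) \<Rightarrow> ('i \<times> nat) cpoly set \<Rightarrow> ('i \<Rightarrow> nat) \<Rightarrow> nat" where
  "hilb I n J a = cpoly.dim (forms I n a) - cpoly.dim (ideal_sections I n J a)"

text \<open>
  The union of the double points supported at the points \<open>p r\<close>, \<open>r \<in> R\<close>: the intersection
  of the squares of their ideals.
\<close>

definition double_points_ideal ::
    "'i set \<Rightarrow> ('i \<Rightarrow> nat) \<Rightarrow> 'r set \<Rightarrow> ('r \<Rightarrow> 'i \<times> nat \<Rightarrow> complex) \<Rightarrow> ('i \<times> nat) cpoly set" where
  "double_points_ideal I n R p =
    {F \<in> coord_ring I n. \<forall>r\<in>R. F \<in> ideal_square I n (point_ideal I n (p r))}"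


section \<open>The statement \<open>T(n; a; s)\<close>\<close>

text \<open>
  ``General'' means: for all \<open>s\<close>-tuples of points in some nonempty Zariski open subset of the
  \<open>s\<close>-fold power of the space. That power is the (irreducible) multiprojective space with
  factors indexed by \<open>{1..s} \<times> {1..k}\<close>, the \<open>(r, i)\<close>-th one being the \<open>i\<close>-th factor of the
  \<open>r\<close>-th copy. Only the entries of \<open>n\<close> and \<open>a\<close> at \<open>1, \<dots>, k\<close> matter.
\<close>

definition T :: "nat \<Rightarrow> (nat \<Rightarrow> nat) \<Rightarrow> (nat \<Rightarrow> nat) \<Rightarrow> nat \<Rightarrow> bool" where
  "T k n a s \<longleftrightarrow>
    (\<exists>U. zariski_open ({1..s} \<times> {1..k}) (\<lambda>(r, i). n i) U \<and> U \<noteq> {} \<and>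
      (\<forall>p\<in>U. hilb {1..k} n
          (double_points_ideal {1..k} n {1..s} (\<lambda>r (i, j). p ((r, i), j))) a
        = min (s * (1 + (\<Sum>i=1..k. n i))) (\<Prod>i=1..k. (n i + a i) choose a i)))"

end

(* For two points p, q with independent homogeneous coordinates on every factor, a linear change of
   coordinates makes them the first two coordinate points of each factor. A form lies in the ideal
   of p^2 iff no monomial of degree at least (sum a) - 1 in the coordinates nonvanishing at p occurs
   in it; there are 1 + sum n such monomials, and likewise for q. Hence the Hilbert function is the
   number of monomials in A Un B for the two resulting sets, and T holds iff A and B are disjoint or
   exhaust all monomials of multidegree a. A common monomial needs sum a <= 2; if sum a <= 1 or some
   n_i = 1 then A and B exhaust everything. What remains is sum a = 2 with all n_i >= 2, where
   x_0 x_1 (resp. x_0 y_1) lies in both sets and x_2^2 (resp. x_2 y_2) in neither. The value found is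
   the general one because two nonempty Zariski open sets meet: restrict the two nonzero polynomials
   to a line joining points where they do not vanish. *)

theory Submission
  imports Defs "HOL-Computational_Algebra.Polynomial" "HOL-Library.FuncSet"
begin

abbreviation "keys \<equiv> Poly_Mapping.keys"
abbreviation "lookup \<equiv> Poly_Mapping.lookup"
abbreviation "single \<equiv> Poly_Mapping.single"

section \<open>Evaluation homomorphisms\<close>

locale rhom =
  fixes f :: "'a::comm_ring_1 \<Rightarrow> 'b::comm_ring_1"
  assumes add: "f (x + y) = f x + f y"
    and mult: "f (x * y) = f x * f y"
    and one: "f 1 = 1"
begin

lemma zero: "f 0 = 0"
  using add[of 0 0] by simp

lemma minus: "f (x - y) = f x - f y"
  using add[of "x - y" y] by simp

lemma sum: "f (\<Sum>i\<in>A. g i) = (\<Sum>i\<in>A. f (g i))"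
  by (induction A rule: infinite_finite_induct) (simp_all add: zero add)

lemma prod: "f (\<Prod>i\<in>A. g i) = (\<Prod>i\<in>A. f (g i))"
  by (induction A rule: infinite_finite_induct) (simp_all add: one mult)

lemma power: "f (x ^ k) = f x ^ k"
  by (induction k) (simp_all add: one mult)

end

definition mon_val :: "('v \<Rightarrow> 'b::comm_ring_1) \<Rightarrow> ('v \<Rightarrow>\<^sub>0 nat) \<Rightarrow> 'b" where
  "mon_val \<sigma> m = (\<Prod>v\<in>keys m. \<sigma> v ^ lookup m v)"

text \<open>The map \<open>h\<close> embeds the constants into the target. Three targets occur: the
  complex numbers (evaluation at a point), univariate polynomials (restriction to a line) and the
  polynomial ring itself (change of coordinates).\<close>

definition poly_val :: "(complex \<Rightarrow> 'b::comm_ring_1) \<Rightarrow> ('v \<Rightarrow> 'b) \<Rightarrow> 'v cpoly \<Rightarrow> 'b" where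
  "poly_val h \<sigma> F = (\<Sum>m\<in>keys F. h (lookup F m) * mon_val \<sigma> m)"

abbreviation C :: "complex \<Rightarrow> 'v cpoly" where "C \<equiv> single 0"

definition X :: "'v \<Rightarrow> 'v cpoly" where "X v = single (single v 1) 1"

lemma eval_poly_eq: "eval_poly F x = poly_val (\<lambda>c. c) x F"
  by (simp add: eval_poly_def poly_val_def mon_val_def)

lemma mon_val_superset:
  assumes "finite A" "keys m \<subseteq> A"
  shows "mon_val \<sigma> m = (\<Prod>v\<in>A. \<sigma> v ^ lookup m v)"
  unfolding mon_val_def using assms
  by (intro prod.mono_neutral_left) (auto simp: in_keys_iff)

lemma mon_val_add: "mon_val \<sigma> (m + m') = mon_val \<sigma> m * mon_val \<sigma> m'"
proof -
  let ?A = "keys m \<union> keys m'"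
  have "keys (m + m') \<subseteq> ?A" by (rule keys_add)
  then show ?thesis
    by (simp add: mon_val_superset[of ?A] lookup_add power_add prod.distrib)
qed

lemma mon_val_0 [simp]: "mon_val \<sigma> 0 = 1"
  by (simp add: mon_val_def)

lemma mon_val_single [simp]: "mon_val \<sigma> (single v k) = \<sigma> v ^ k"
  by (simp add: mon_val_def)

lemma poly_mapping_sum_single: "F = (\<Sum>m\<in>keys F. single m (lookup F m))"
  by (rule poly_mapping_eqI)
    (auto simp: lookup_sum lookup_single when_def in_keys_iff)

lemma id_rhom: "rhom (\<lambda>c. c)"
  by unfold_locales auto

lemma C_rhom: "rhom C"
  by unfold_locales (auto simp: single_add mult_single)

lemma const_poly_rhom: "rhom (\<lambda>c. [:c:])"
  by unfold_locales auto

lemma poly_eval_rhom: "rhom (\<lambda>P. poly P t)"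
  by unfold_locales auto

context rhom
begin

lemma mon_val: "f (mon_val \<sigma> m) = mon_val (\<lambda>v. f (\<sigma> v)) m"
  by (simp add: mon_val_def prod power)

lemma poly_val: "f (poly_val h \<sigma> F) = poly_val (\<lambda>c. f (h c)) (\<lambda>v. f (\<sigma> v)) F"
  by (simp add: poly_val_def sum mult mon_val)

end

context
  fixes h :: "complex \<Rightarrow> 'b::comm_ring_1" and \<sigma> :: "'v \<Rightarrow> 'b"
  assumes h: "rhom h"
begin

lemma poly_val_superset:
  assumes "finite A" "keys F \<subseteq> A"
  shows "poly_val h \<sigma> F = (\<Sum>m\<in>A. h (lookup F m) * mon_val \<sigma> m)"
  unfolding poly_val_def using assms
  by (intro sum.mono_neutral_left) (auto simp: in_keys_iff rhom.zero[OF h])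

lemma poly_val_add: "poly_val h \<sigma> (F + G) = poly_val h \<sigma> F + poly_val h \<sigma> G"
proof -
  let ?A = "keys F \<union> keys G"
  have "keys (F + G) \<subseteq> ?A" by (rule keys_add)
  then show ?thesis
    by (simp add: poly_val_superset[of ?A] lookup_add rhom.add[OF h] distrib_right sum.distrib)
qed

lemma poly_val_single: "poly_val h \<sigma> (single m c) = h c * mon_val \<sigma> m"
  by (simp add: poly_val_def rhom.zero[OF h])

lemma poly_val_zero: "poly_val h \<sigma> 0 = 0"
  by (simp add: poly_val_def)

lemma poly_val_sum: "poly_val h \<sigma> (\<Sum>i\<in>A. F i) = (\<Sum>i\<in>A. poly_val h \<sigma> (F i))"
  by (induction A rule: infinite_finite_induct) (simp_all add: poly_val_add poly_val_zero)

lemma poly_val_mult: "poly_val h \<sigma> (F * G) = poly_val h \<sigma> F * poly_val h \<sigma> G"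
proof -
  let ?s = "\<lambda>F m. single m (lookup F m)"
  have "F * G = (\<Sum>m\<in>keys F. \<Sum>m'\<in>keys G. ?s F m * ?s G m')"
    by (subst (1) poly_mapping_sum_single[of F], subst (1) poly_mapping_sum_single[of G])
      (simp only: sum_product)
  also have "poly_val h \<sigma> \<dots> = (\<Sum>m\<in>keys F. \<Sum>m'\<in>keys G.
      (h (lookup F m) * mon_val \<sigma> m) * (h (lookup G m') * mon_val \<sigma> m'))"
    by (simp add: poly_val_sum mult_single poly_val_single mon_val_add rhom.mult[OF h] mult_ac)
  also have "\<dots> = poly_val h \<sigma> F * poly_val h \<sigma> G"
    by (simp only: poly_val_def sum_product)
  finally show ?thesis .
qed

lemma poly_val_rhom: "rhom (poly_val h \<sigma>)"
proof
  show "poly_val h \<sigma> 1 = 1"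
    using poly_val_single[of 0 1] by (simp add: rhom.one[OF h])
qed (simp_all add: poly_val_add poly_val_mult)

lemma poly_val_X: "poly_val h \<sigma> (X v) = \<sigma> v"
  by (simp add: X_def poly_val_single rhom.one[OF h])

lemma poly_val_C: "poly_val h \<sigma> (C c) = h c"
  by (simp add: poly_val_single)

end

lemma poly_val_cong:
  assumes "\<And>m v. m \<in> keys F \<Longrightarrow> v \<in> keys m \<Longrightarrow> \<sigma> v = \<tau> v"
  shows "poly_val h \<sigma> F = poly_val h \<tau> F"
  unfolding poly_val_def mon_val_def using assms
  by (intro sum.cong arg_cong2[of _ _ _ _ "(*)"] prod.cong) auto

lemma mon_val_X: "mon_val X m = single m 1"
proof -
  have X_power: "X v ^ k = single (single v k) 1" for v :: 'a and k
    by (induction k) (simp_all add: X_def mult_single flip: single_add)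
  have "(\<Prod>v\<in>A. X v ^ lookup m v) = single (\<Sum>v\<in>A. single v (lookup m v)) 1" if "finite A" for A
    using that by (induction A) (simp_all add: X_power mult_single)
  then show ?thesis
    by (simp add: mon_val_def flip: poly_mapping_sum_single)
qed

text \<open>The identity substitution: it shows that the two coordinate changes are mutually
  inverse, and it presents the full space of forms as an image to which
  \<open>dim_image_singles\<close> applies.\<close>

lemma poly_val_C_X: "poly_val C X F = F"
  by (simp add: poly_val_def mon_val_X mult_single flip: poly_mapping_sum_single)

lemma eval_rhom: "rhom (\<lambda>F. eval_poly F x)"
  unfolding eval_poly_eq by (rule poly_val_rhom[OF id_rhom])

section \<open>Multihomogeneous forms\<close>

definition mons :: "'i set \<Rightarrow> ('i \<Rightarrow> nat) \<Rightarrow> ('i \<Rightarrow> nat) \<Rightarrow> ('i \<times> nat \<Rightarrow>\<^sub>0 nat) set" where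
  "mons I n d = {m. keys m \<subseteq> mvars I n \<and> (\<forall>i\<in>I. (\<Sum>j\<le>n i. lookup m (i, j)) = d i)}"

lemma forms_iff: "F \<in> forms I n d \<longleftrightarrow> keys F \<subseteq> mons I n d"
  by (auto simp: forms_def coord_ring_def mons_def)

lemma forms_coord_ring: "F \<in> forms I n d \<Longrightarrow> F \<in> coord_ring I n"
  by (simp add: forms_def)

lemma forms_cong: "(\<And>i. i \<in> I \<Longrightarrow> d i = d' i) \<Longrightarrow> forms I n d = forms I n d'"
  by (simp add: forms_def)

lemma mons_add:
  assumes "m \<in> mons I n d" "m' \<in> mons I n d'"
  shows "m + m' \<in> mons I n (\<lambda>i. d i + d' i)"
  using assms keys_add[of m m'] by (auto simp: mons_def lookup_add sum.distrib)

lemma forms_zero: "0 \<in> forms I n d"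
  by (simp add: forms_iff)

lemma forms_add: "F \<in> forms I n d \<Longrightarrow> G \<in> forms I n d \<Longrightarrow> F + G \<in> forms I n d"
  using keys_add[of F G] by (auto simp: forms_iff)

lemma forms_mult:
  assumes "F \<in> forms I n d" "G \<in> forms I n d'"
  shows "F * G \<in> forms I n (\<lambda>i. d i + d' i)"
  unfolding forms_iff
proof
  fix m assume "m \<in> keys (F * G)"
  then obtain m1 m2 where "m = m1 + m2" "m1 \<in> keys F" "m2 \<in> keys G"
    using keys_mult[of F G] by blast
  then show "m \<in> mons I n (\<lambda>i. d i + d' i)"
    using assms by (auto simp: forms_iff intro: mons_add)
qed

lemma forms_C: "C c \<in> forms I n (\<lambda>_. 0)"
  by (auto simp: forms_iff mons_def)

lemma forms_one: "1 \<in> forms I n (\<lambda>_. 0)"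
  using forms_C[of 1] by simp

lemma forms_C_mult: "F \<in> forms I n d \<Longrightarrow> C c * F \<in> forms I n d"
  using forms_mult[OF forms_C, of F I n d c] by simp

lemma forms_diff: "F \<in> forms I n d \<Longrightarrow> G \<in> forms I n d \<Longrightarrow> F - G \<in> forms I n d"
  using keys_diff[of F G] by (auto simp: forms_iff)

lemma forms_sum: "(\<And>i. i \<in> A \<Longrightarrow> F i \<in> forms I n d) \<Longrightarrow> (\<Sum>i\<in>A. F i) \<in> forms I n d"
  by (induction A rule: infinite_finite_induct) (auto simp: forms_zero forms_add)

lemma forms_prod:
  "(\<And>v. v \<in> A \<Longrightarrow> F v \<in> forms I n (d v)) \<Longrightarrow> (\<Prod>v\<in>A. F v) \<in> forms I n (\<lambda>i. \<Sum>v\<in>A. d v i)"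
proof (induction A rule: infinite_finite_induct)
  case (insert v A)
  then show ?case
    using forms_mult[of "F v" I n "d v" "\<Prod>v\<in>A. F v"] by simp
qed (simp_all add: forms_one)

lemma forms_power: "F \<in> forms I n d \<Longrightarrow> F ^ k \<in> forms I n (\<lambda>i. k * d i)"
proof (induction k)
  case (Suc k)
  then show ?case
    using forms_mult[of F I n d "F ^ k"] by simp
qed (simp add: forms_one)

abbreviation unit_deg :: "'i \<Rightarrow> 'i \<Rightarrow> nat" where
  "unit_deg i \<equiv> (\<lambda>i'. if i' = i then 1 else 0)"

lemma X_forms:
  assumes "i \<in> I" "j \<le> n i"
  shows "X (i, j) \<in> forms I n (unit_deg i)"
  using assms
  by (auto simp: X_def forms_iff mons_def mvars_def lookup_single when_def sum.delta)

lemma sum_keys_fst: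
  assumes "keys m \<subseteq> mvars I n" "i \<in> I"
  shows "(\<Sum>v\<in>keys m. lookup m v * unit_deg (fst v) i) = (\<Sum>j\<le>n i. lookup m (i, j))"
proof -
  have "(\<Sum>v\<in>keys m. lookup m v * unit_deg (fst v) i) = (\<Sum>v\<in>keys m \<inter> {i} \<times> UNIV. lookup m v)"
    by (rule sum.mono_neutral_cong_right) auto
  also have "\<dots> = (\<Sum>v\<in>Pair i ` {..n i}. lookup m v)"
    using assms by (intro sum.mono_neutral_left) (auto simp: mvars_def in_keys_iff)
  also have "\<dots> = (\<Sum>j\<le>n i. lookup m (i, j))"
    by (subst sum.reindex) (auto simp: inj_on_def)
  finally show ?thesis .
qed

text \<open>Each variable is replaced by a linear form on its own factor, so the exponents over
  factor \<open>i\<close> still add up to the degree on that factor.\<close>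

lemma mon_val_forms:
  assumes "\<And>v. v \<in> mvars I n \<Longrightarrow> \<sigma> v \<in> forms I n (unit_deg (fst v))" and m: "m \<in> mons I n d"
  shows "mon_val \<sigma> m \<in> forms I n d"
proof -
  have deg: "(\<Sum>v\<in>keys m. lookup m v * unit_deg (fst v) i) = d i" if "i \<in> I" for i
    using m that sum_keys_fst[of m I n i] unfolding mons_def by auto
  have "mon_val \<sigma> m \<in> forms I n (\<lambda>i. \<Sum>v\<in>keys m. lookup m v * unit_deg (fst v) i)"
    unfolding mon_val_def using assms by (intro forms_prod forms_power) (auto simp: mons_def)
  \<comment> \<open>The two degree functions agree on \<open>I\<close>, and membership in
    \<open>forms\<close> depends only on the degrees there.\<close>
  also have "\<dots> = forms I n d"
    by (rule forms_cong) (rule deg)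
  finally show ?thesis .
qed

lemma poly_val_forms:
  assumes "\<And>v. v \<in> mvars I n \<Longrightarrow> \<sigma> v \<in> forms I n (unit_deg (fst v))" and "F \<in> forms I n d"
  shows "poly_val C \<sigma> F \<in> forms I n d"
  unfolding poly_val_def using assms
  by (intro forms_sum forms_C_mult mon_val_forms) (auto simp: forms_iff)

section \<open>Ideals of points and their squares\<close>

lemma coord_ring_mult: "F \<in> coord_ring I n \<Longrightarrow> G \<in> coord_ring I n \<Longrightarrow> F * G \<in> coord_ring I n"
  unfolding coord_ring_def
proof (intro CollectI ballI)
  fix m assume "F \<in> {F. \<forall>m\<in>keys F. keys m \<subseteq> mvars I n}"
    "G \<in> {F. \<forall>m\<in>keys F. keys m \<subseteq> mvars I n}" and "m \<in> keys (F * G)"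
  moreover from this obtain m1 m2 where "m = m1 + m2" "m1 \<in> keys F" "m2 \<in> keys G"
    using keys_mult[of F G] by blast
  ultimately show "keys m \<subseteq> mvars I n"
    using keys_add[of m1 m2] by blast
qed

lemma ideal_gen_gen:
  assumes "g \<in> G"
  shows "g \<in> ideal_gen I n G"
proof -
  have "1 \<in> coord_ring I n" by (rule forms_coord_ring[OF forms_one])
  then show ?thesis
    unfolding ideal_gen_def using assms
    by (intro CollectI exI[of _ "{g}"] exI[of _ "\<lambda>_. 1"]) auto
qed

lemma ideal_gen_zero: "0 \<in> ideal_gen I n G"
  unfolding ideal_gen_def by (intro CollectI exI[of _ "{}"]) auto

lemma coord_ring_zero: "0 \<in> coord_ring I n"
  by (simp add: coord_ring_def)

lemma coord_ring_add: "F \<in> coord_ring I n \<Longrightarrow> G \<in> coord_ring I n \<Longrightarrow> F + G \<in> coord_ring I n"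
  using keys_add[of F G] by (auto simp: coord_ring_def)

lemma ideal_gen_add:
  assumes "f \<in> ideal_gen I n G" "f' \<in> ideal_gen I n G"
  shows "f + f' \<in> ideal_gen I n G"
proof -
  obtain A c where A: "f = (\<Sum>g\<in>A. c g * g)" "finite A" "A \<subseteq> G" "\<forall>g\<in>A. c g \<in> coord_ring I n"
    using assms(1) by (auto simp: ideal_gen_def)
  obtain B e where B: "f' = (\<Sum>g\<in>B. e g * g)" "finite B" "B \<subseteq> G" "\<forall>g\<in>B. e g \<in> coord_ring I n"
    using assms(2) by (auto simp: ideal_gen_def)
  \<comment> \<open>Both combinations are extended by zero coefficients to the union of their sets
    of generators.\<close>
  let ?k = "\<lambda>g. (if g \<in> A then c g else 0) + (if g \<in> B then e g else 0)"
  have "f = (\<Sum>g\<in>A \<union> B. (if g \<in> A then c g else 0) * g)"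
    unfolding A(1) using A(2) B(2) by (intro sum.mono_neutral_cong_left) auto
  moreover have "f' = (\<Sum>g\<in>A \<union> B. (if g \<in> B then e g else 0) * g)"
    unfolding B(1) using A(2) B(2) by (intro sum.mono_neutral_cong_left) auto
  ultimately have "f + f' = (\<Sum>g\<in>A \<union> B. ?k g * g)"
    by (simp only: distrib_right sum.distrib)
  moreover have "\<forall>g\<in>A \<union> B. ?k g \<in> coord_ring I n"
    using A(4) B(4) by (auto intro!: coord_ring_add simp: coord_ring_zero)
  ultimately show ?thesis
    unfolding ideal_gen_def using A(2,3) B(2,3)
    by (intro CollectI exI[of _ "A \<union> B"] exI[of _ ?k] conjI) simp_all
qed

lemma ideal_gen_sum: "(\<And>i. i \<in> A \<Longrightarrow> f i \<in> ideal_gen I n G) \<Longrightarrow> (\<Sum>i\<in>A. f i) \<in> ideal_gen I n G"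
  by (induction A rule: infinite_finite_induct) (auto simp: ideal_gen_zero ideal_gen_add)

lemma ideal_gen_mult:
  assumes "f \<in> ideal_gen I n G" "r \<in> coord_ring I n"
  shows "r * f \<in> ideal_gen I n G"
proof -
  obtain A c where A: "f = (\<Sum>g\<in>A. c g * g)" "finite A" "A \<subseteq> G" "\<forall>g\<in>A. c g \<in> coord_ring I n"
    using assms(1) by (auto simp: ideal_gen_def)
  have "r * f = (\<Sum>g\<in>A. (r * c g) * g)"
    by (simp add: A(1) sum_distrib_left mult.assoc)
  moreover have "\<forall>g\<in>A. r * c g \<in> coord_ring I n"
    using A assms(2) by (auto intro: coord_ring_mult)
  ultimately show ?thesis
    unfolding ideal_gen_def using A
    by (intro CollectI exI[of _ A] exI[of _ "\<lambda>g. r * c g"]) auto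
qed

section \<open>Restriction to lines through a point\<close>

definition line :: "('v \<Rightarrow> complex) \<Rightarrow> ('v \<Rightarrow> complex) \<Rightarrow> 'v cpoly \<Rightarrow> complex poly" where
  "line x u F = poly_val (\<lambda>c. [:c:]) (\<lambda>v. [:x v, u v:]) F"

lemma line_rhom: "rhom (line x u)"
  unfolding line_def[abs_def] by (rule poly_val_rhom[OF const_poly_rhom])

lemma poly_line: "poly (line x u F) t = eval_poly F (\<lambda>v. x v + t * u v)"
  by (simp add: line_def eval_poly_eq rhom.poly_val[OF poly_eval_rhom])

lemma ideal_gen_line_dvd:
  assumes "f \<in> ideal_gen I n G" "\<And>g. g \<in> G \<Longrightarrow> P dvd line x u g"
  shows "P dvd line x u f"
proof -
  obtain A c where "f = (\<Sum>g\<in>A. c g * g)" "A \<subseteq> G"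
    using assms(1) by (auto simp: ideal_gen_def)
  with assms(2) show ?thesis
    by (auto simp: rhom.sum[OF line_rhom] rhom.mult[OF line_rhom] intro!: dvd_sum dvd_mult)
qed

text \<open>The line \<open>p + t u\<close> passes through \<open>p\<close> at \<open>t = 0\<close>,
  so a generator restricts to a polynomial in \<open>t\<close> without constant term.\<close>

lemma point_ideal_line_dvd:
  assumes "f \<in> point_ideal I n p"
  shows "monom 1 1 dvd line p u f"
  using assms unfolding point_ideal_def
  by (rule ideal_gen_line_dvd)
    (use poly_line[of p u _ 0] in \<open>auto simp: monom_1_dvd_iff' poly_0_coeff_0\<close>)

lemma ideal_square_line_dvd:
  assumes "f \<in> ideal_square I n (point_ideal I n p)"
  shows "monom 1 2 dvd line p u f"
proof -
  have "monom 1 2 dvd line p u (g * g')"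
    if "g \<in> point_ideal I n p" "g' \<in> point_ideal I n p" for g g'
    using mult_dvd_mono[OF that[THEN point_ideal_line_dvd, of u]]
    by (simp add: mult_monom rhom.mult[OF line_rhom] numeral_2_eq_2)
  then show ?thesis
    using assms[unfolded ideal_square_def] by (elim ideal_gen_line_dvd) auto
qed

text \<open>The multiplier \<open>H\<close> from the localization at \<open>p\<close> has nonzero
  constant term along the line, so it can be cancelled modulo \<open>t^2\<close>. Hence
  \<open>F\<close> itself has vanishing 1-jet at \<open>p\<close> in every direction.\<close>

lemma ideal_sections_line:
  assumes F: "F \<in> ideal_sections I n J a" and J: "J \<subseteq> ideal_square I n (point_ideal I n p)"
    and p: "p \<in> points I n" and "k < 2"
  shows "coeff (line p u F) k = 0"
proof -
  obtain H where H: "eval_poly H p \<noteq> 0" "H * F \<in> J"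
    using F p by (auto simp: ideal_sections_def)
  let ?P = "line p u H" and ?Q = "line p u F"
  have "monom 1 2 dvd ?P * ?Q"
    using ideal_square_line_dvd[of "H * F" I n p u] H J by (auto simp: rhom.mult[OF line_rhom])
  then have "coeff (?P * ?Q) 0 = 0" "coeff (?P * ?Q) 1 = 0"
    by (simp_all add: monom_1_dvd_iff')
  moreover have "coeff ?P 0 \<noteq> 0"
    using H(1) poly_line[of p u H 0] by (simp add: poly_0_coeff_0)
  ultimately have "coeff ?Q 0 = 0 \<and> coeff ?Q 1 = 0"
    by (simp add: coeff_mult)
  then show ?thesis
    using \<open>k < 2\<close> by (auto simp: less_2_cases_iff)
qed

section \<open>Dimensions of spaces spanned by monomials\<close>

lemma linear_poly_val_C: "Vector_Spaces.linear scale_poly scale_poly (poly_val C \<sigma>)"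
proof
  interpret rhom "poly_val C \<sigma>" by (rule poly_val_rhom[OF C_rhom])
  show "poly_val C \<sigma> (F + G) = poly_val C \<sigma> F + poly_val C \<sigma> G" for F G :: "'a cpoly"
    by (rule add)
  show "poly_val C \<sigma> (scale_poly c F) = scale_poly c (poly_val C \<sigma> F)" for c and F :: "'a cpoly"
    by (simp add: scale_poly_def mult poly_val_C[OF C_rhom])
qed

lemma span_singles:
  assumes "finite B"
  shows "cpoly.span ((\<lambda>m. single m 1) ` B) = {F. keys F \<subseteq> B}" (is "?L = ?R")
proof
  have "cpoly.subspace ?R"
  proof (rule cpoly.subspaceI)
    show "F + G \<in> ?R" if "F \<in> ?R" "G \<in> ?R" for F G
      using that keys_add[of F G] by auto
    show "scale_poly c F \<in> ?R" if "F \<in> ?R" for c F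
      using that keys_mult[of "C c" F] by (auto simp: scale_poly_def split: if_splits)
  qed auto
  then show "?L \<subseteq> ?R"
    by (intro cpoly.span_minimal) auto
  show "?R \<subseteq> ?L"
  proof
    fix F assume F: "F \<in> ?R"
    have "F = (\<Sum>m\<in>keys F. scale_poly (lookup F m) (single m 1))"
      by (subst (1) poly_mapping_sum_single[of F]) (simp add: scale_poly_def mult_single)
    also have "\<dots> \<in> ?L"
      using F by (intro cpoly.span_sum cpoly.span_scale cpoly.span_base) auto
    finally show "F \<in> ?L" .
  qed
qed

lemma independent_singles: "cpoly.independent ((\<lambda>m. single m 1) ` B)"
  unfolding cpoly.independent_explicit_module
proof (intro allI impI)
  fix T c v
  assume T: "finite T" "T \<subseteq> (\<lambda>m. single m 1) ` B" "(\<Sum>v\<in>T. scale_poly (c v) v) = 0" "v \<in> T"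
  then obtain m where m: "v = single m 1" by auto
  have "c v = (\<Sum>w\<in>T. if w = v then c w else 0)"
    using T by simp
  also have "\<dots> = (\<Sum>w\<in>T. lookup (scale_poly (c w) w) m)"
    using T(2) m by (intro sum.cong)
      (auto simp: scale_poly_def mult_single lookup_single when_def)
  also have "\<dots> = 0"
    using T(3) by (simp flip: lookup_sum)
  finally show "c v = 0" .
qed

text \<open>The spaces to be measured are images of spans of monomials under coordinate changes;
  injectivity turns the monomial basis into a basis of the image.\<close>

lemma dim_image_singles:
  assumes B: "finite B" and f: "Vector_Spaces.linear scale_poly scale_poly f"
    and inj: "inj_on f {F. keys F \<subseteq> B}"
  shows "cpoly.dim (f ` {F. keys F \<subseteq> B}) = card B"
proof -
  interpret f: Vector_Spaces.linear scale_poly scale_poly f by (rule f)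
  let ?S = "(\<lambda>m. single m (1::complex)) ` B"
  have span: "cpoly.span ?S = {F. keys F \<subseteq> B}"
    by (rule span_singles[OF B])
  have ind: "cpoly.independent (f ` ?S)"
    using independent_singles inj span by (intro f.independent_injective_image) auto
  have "f ` {F. keys F \<subseteq> B} = cpoly.span (f ` ?S)"
    by (simp only: f.span_image span)
  then have "cpoly.dim (f ` {F. keys F \<subseteq> B}) = card (f ` ?S)"
    by (simp add: cpoly.dim_eq_card_independent[OF ind])
  also have "\<dots> = card ?S"
    by (rule card_image, rule inj_on_subset[OF inj]) auto
  also have "\<dots> = card B"
    by (intro card_image inj_onI) (metis keys_single singleton_inject zero_neq_one)
  finally show ?thesis .
qed

section \<open>Monomials seen by a double point\<close>

text \<open>The monomials of multidegree \<open>d\<close> whose coefficients make up the 1-jet of a form at the point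
  where on each factor exactly the \<open>c\<close>-th coordinate is nonzero.\<close>

definition jet_mons :: "'i set \<Rightarrow> ('i \<Rightarrow> nat) \<Rightarrow> ('i \<Rightarrow> nat) \<Rightarrow> nat \<Rightarrow> ('i \<times> nat \<Rightarrow>\<^sub>0 nat) set" where
  "jet_mons I n d c = {m \<in> mons I n d. (\<Sum>v\<in>{v \<in> keys m. snd v \<noteq> c}. lookup m v) \<le> 1}"

text \<open>The exponents at indices other than \<open>c\<close> add up to at least 2, so two such
  variables, possibly equal, can be factored out. After substitution they become two linear forms
  vanishing at the point.\<close>

lemma not_jet_mons_split:
  assumes m: "m \<in> mons I n d" "m \<notin> jet_mons I n d c"
  obtains v w m' where "m = single v 1 + (single w 1 + m')" "v \<in> mvars I n" "w \<in> mvars I n"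
    "snd v \<noteq> c" "snd w \<noteq> c" "keys m' \<subseteq> mvars I n"
proof -
  let ?S = "{v \<in> keys m. snd v \<noteq> c}"
  have sum: "(\<Sum>v\<in>?S. lookup m v) \<ge> 2"
    using m by (auto simp: jet_mons_def)
  have split: "\<exists>v\<in>A. \<exists>m''. m' = single v 1 + m''"
    if nz: "(\<Sum>v\<in>A. lookup m' v) \<noteq> 0" for m' :: "'a \<times> nat \<Rightarrow>\<^sub>0 nat" and A
  proof -
    obtain v where v: "v \<in> A" "lookup m' v \<noteq> 0"
      using nz by (rule sum.not_neutral_contains_not_neutral)
    have "m' = single v 1 + (m' - single v 1)"
    proof (rule poly_mapping_eqI)
      show "lookup m' u = lookup (single v 1 + (m' - single v 1)) u" for u
        using v(2) by (cases "u = v") (simp_all add: lookup_add lookup_minus lookup_single_not_eq)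
    qed
    with v(1) show ?thesis by blast
  qed
  obtain v m1 where v: "v \<in> ?S" "m = single v 1 + m1"
  proof -
    have "(\<Sum>v\<in>?S. lookup m v) \<noteq> 0" using sum by linarith
    from split[OF this] show thesis by (elim bexE exE) (rule that)
  qed
  \<comment> \<open>The index set stays that of \<open>m\<close>, so removing \<open>v\<close>
    lowers the sum by exactly one, even if \<open>v\<close> no longer occurs in \<open>m1\<close>.
    At least one is left for \<open>w\<close>.\<close>
  have "(\<Sum>u\<in>?S. lookup m u) = 1 + (\<Sum>u\<in>?S. lookup m1 u)"
    using v(1) by (simp add: v(2) lookup_add sum.distrib lookup_single when_def)
  then obtain w m2 where w: "w \<in> ?S" "m1 = single w 1 + m2"
  proof -
    assume "(\<Sum>u\<in>?S. lookup m u) = 1 + (\<Sum>u\<in>?S. lookup m1 u)"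
    then have "(\<Sum>u\<in>?S. lookup m1 u) \<noteq> 0" using sum by linarith
    from split[OF this] show thesis by (elim bexE exE) (rule that)
  qed
  have "keys m2 \<subseteq> keys m"
    by (auto simp: v(2) w(2) in_keys_iff lookup_add)
  with v w m(1) show thesis
    by (intro that[of v w m2]) (auto simp: mons_def)
qed

lemma jet_mons_support:
  assumes m: "m \<in> jet_mons I n d c" and I: "I \<noteq> {}" "\<And>i. i \<in> I \<Longrightarrow> n i \<ge> 1"
  obtains v where "snd v \<noteq> c" "lookup m v \<le> 1" "\<And>w. w \<in> keys m \<Longrightarrow> snd w \<noteq> c \<Longrightarrow> w = v"
proof (cases "{v \<in> keys m. snd v \<noteq> c} = {}")
  case True
  \<comment> \<open>Any pair with second entry different from \<open>c\<close> serves here: it does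
    not occur in \<open>m\<close>, so its exponent is 0.\<close>
  let ?v = "(undefined :: 'a, Suc c)"
  have "snd ?v \<noteq> c" by simp
  with True have "?v \<notin> keys m" by blast
  then have "lookup m ?v \<le> 1" by (simp add: in_keys_iff)
  with True \<open>snd ?v \<noteq> c\<close> show thesis
    by (intro that[of ?v]) blast+
next
  case False
  let ?S = "{v \<in> keys m. snd v \<noteq> c}"
  from False obtain v where v: "v \<in> ?S" by blast
  have le: "(\<Sum>u\<in>?S. lookup m u) \<le> 1" using m by (simp add: jet_mons_def)
  have "w = v" if "w \<in> ?S" for w
  proof (rule ccontr)
    assume "w \<noteq> v"
    then have "lookup m w + lookup m v \<le> (\<Sum>u\<in>?S. lookup m u)"
      using v that sum_mono2[of ?S "{w, v}" "lookup m"] by auto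
    with le v that show False by (auto simp: in_keys_iff)
  qed
  moreover have "lookup m v \<le> 1"
    using le v member_le_sum[of v ?S "lookup m"] by auto
  ultimately show thesis using v by (intro that[of v]) blast+
qed

section \<open>Reading off jet coefficients along coordinate lines\<close>

abbreviation corner :: "nat \<Rightarrow> 'i \<times> nat \<Rightarrow> complex" where
  "corner c \<equiv> (\<lambda>w. if snd w = c then 1 else 0)"

abbreviation dir :: "'i \<times> nat \<Rightarrow> 'i \<times> nat \<Rightarrow> complex" where
  "dir v \<equiv> (\<lambda>w. if w = v then 1 else 0)"

text \<open>The exponents at indices other than \<open>c\<close> determine a monomial of given
  multidegree, because the degree on each factor then fixes the exponent of its \<open>c\<close>-th
  coordinate. Here \<open>v\<close> is the only such variable that may occur.\<close>

lemma mons_eqI: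
  assumes m: "m \<in> mons I n d" "\<And>w. w \<in> keys m \<Longrightarrow> snd w \<noteq> c \<Longrightarrow> w = v"
    and m': "m' \<in> mons I n d" "\<And>w. w \<in> keys m' \<Longrightarrow> snd w \<noteq> c \<Longrightarrow> w = v"
    and v: "snd v \<noteq> c" "lookup m v = lookup m' v"
  shows "m = m'"
proof (rule poly_mapping_eqI)
  fix w
  have deg: "d (fst w) = lookup m'' w + (\<Sum>j\<in>{..n (fst w)} - {c}. lookup m'' (fst w, j))"
    if "m'' \<in> mons I n d" "w \<in> mvars I n" "snd w = c" for m''
    using that by (auto simp: mons_def mvars_def sum.remove)
  have off: "lookup m u = lookup m' u" if "snd u \<noteq> c" for u
    using that m(2) m'(2) v by (metis in_keys_iff)
  consider "w \<notin> mvars I n" | "snd w \<noteq> c" | "w \<in> mvars I n" "snd w = c" by blast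
  then show "lookup m w = lookup m' w"
  proof cases
    case 1
    then have "w \<notin> keys m" "w \<notin> keys m'" using m(1) m'(1) by (auto simp: mons_def)
    then show ?thesis by (simp add: in_keys_iff)
  next
    case 3
    have "(\<Sum>j\<in>{..n (fst w)} - {c}. lookup m (fst w, j)) = (\<Sum>j\<in>{..n (fst w)} - {c}. lookup m' (fst w, j))"
      by (intro sum.cong refl off) auto
    with deg[OF m(1) 3] deg[OF m'(1) 3] show ?thesis by simp
  qed (rule off)
qed

text \<open>On the line from \<open>corner c\<close> in direction \<open>dir v\<close> the
  \<open>c\<close>-th coordinates are 1, \<open>v\<close> is the parameter, and all other
  coordinates vanish.\<close>

lemma mon_val_line:
  assumes "snd v \<noteq> c"
  shows "mon_val (\<lambda>w. [:corner c w, dir v w:]) m =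
    (if \<forall>w\<in>keys m. snd w \<noteq> c \<longrightarrow> w = v then monom 1 (lookup m v) else 0)"
proof (cases "\<forall>w\<in>keys m. snd w \<noteq> c \<longrightarrow> w = v")
  case True
  have "mon_val (\<lambda>w. [:corner c w, dir v w:]) m
      = (\<Prod>w\<in>keys m. if w = v then [:0, 1:] ^ lookup m w else 1)"
    unfolding mon_val_def
  proof (rule prod.cong)
    fix w assume "w \<in> keys m"
    with True consider "w = v" | "w \<noteq> v" "snd w = c" by blast
    then show "[:corner c w, dir v w:] ^ lookup m w = (if w = v then [:0, 1:] ^ lookup m w else 1)"
      using assms by cases (simp_all flip: one_pCons)
  qed simp
  also have "\<dots> = (if v \<in> keys m then [:0, 1:] ^ lookup m v else 1)"
    by (simp add: prod.delta)
  also have "\<dots> = monom 1 (lookup m v)"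
    by (simp add: monom_altdef in_keys_iff)
  finally show ?thesis using True by simp
next
  case False
  then obtain w where "w \<in> keys m" "snd w \<noteq> c" "w \<noteq> v" by blast
  then have "mon_val (\<lambda>w. [:corner c w, dir v w:]) m = 0"
    unfolding mon_val_def by (intro prod_zero bexI[of _ w]) (simp_all add: in_keys_iff)
  then show ?thesis using False by argo
qed

text \<open>By \<open>mons_eqI\<close>, \<open>m\<close> is the only monomial of multidegree
  \<open>d\<close> whose restriction to this line is that power of the parameter, so nothing else
  contributes to the coefficient.\<close>

lemma coeff_line_corner:
  assumes G: "G \<in> forms I n d" and m: "m \<in> mons I n d"
    and v: "snd v \<noteq> c" "\<And>w. w \<in> keys m \<Longrightarrow> snd w \<noteq> c \<Longrightarrow> w = v"
  shows "coeff (line (corner c) (dir v) G) (lookup m v) = lookup G m"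
proof -
  define Q where "Q m' \<longleftrightarrow> (\<forall>w\<in>keys m'. snd w \<noteq> c \<longrightarrow> w = v)"
    for m' :: "'a \<times> nat \<Rightarrow>\<^sub>0 nat"
  have "coeff (line (corner c) (dir v) G) (lookup m v) =
      (\<Sum>m'\<in>keys G. lookup G m' *
        coeff (mon_val (\<lambda>w. [:corner c w, dir v w:]) m') (lookup m v))"
    by (simp add: line_def poly_val_def coeff_sum)
  also have "\<dots> = (\<Sum>m'\<in>keys G. if m' = m then lookup G m' else 0)"
  proof (rule sum.cong)
    fix m' assume "m' \<in> keys G"
    then have "m' \<in> mons I n d" using G by (auto simp: forms_iff)
    then have uniq: "m' = m" if "Q m'" "lookup m' v = lookup m v"
      using that m v unfolding Q_def by (intro mons_eqI[of m' I n d c v m]) blast+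
    have "Q m" using v(2) by (auto simp: Q_def)
    then show "lookup G m' * coeff (mon_val (\<lambda>w. [:corner c w, dir v w:]) m') (lookup m v)
        = (if m' = m then lookup G m' else 0)"
      using uniq unfolding mon_val_line[OF v(1)] Q_def[symmetric] by (cases "m' = m") auto
  qed simp
  also have "\<dots> = lookup G m"
    by (simp add: in_keys_iff)
  finally show ?thesis .
qed

section \<open>Coordinates adapted to two points\<close>

text \<open>On each factor the nonzero minor makes the vectors of \<open>p\<close> and
  \<open>q\<close>, together with the standard basis vectors of index at least 2, a basis.\<close>

locale two_points =
  fixes I :: "'i set" and n :: "'i \<Rightarrow> nat" and p q :: "'i \<times> nat \<Rightarrow> complex"
  assumes finite_I: "finite I" and I_nonempty: "I \<noteq> {}" and n_pos: "i \<in> I \<Longrightarrow> n i \<ge> 1"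
    and minor: "i \<in> I \<Longrightarrow> p (i, 0) * q (i, 1) - p (i, 1) * q (i, 0) \<noteq> 0"
begin

definition det :: "'i \<Rightarrow> complex" where
  "det i = p (i, 0) * q (i, 1) - p (i, 1) * q (i, 0)"

text \<open>The old coordinates in terms of the new ones, in which \<open>p\<close> and \<open>q\<close> are the first two
  coordinate points of each factor, and conversely.\<close>

definition old :: "'i \<times> nat \<Rightarrow> ('i \<times> nat) cpoly" where
  "old = (\<lambda>(i, j). C (p (i, j)) * X (i, 0) + C (q (i, j)) * X (i, 1)
     + (if j \<ge> 2 then X (i, j) else 0))"

definition new0 :: "'i \<Rightarrow> ('i \<times> nat) cpoly" where
  "new0 i = C (1 / det i) * (C (q (i, 1)) * X (i, 0) - C (q (i, 0)) * X (i, 1))"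

definition new1 :: "'i \<Rightarrow> ('i \<times> nat) cpoly" where
  "new1 i = C (1 / det i) * (C (p (i, 0)) * X (i, 1) - C (p (i, 1)) * X (i, 0))"

definition new :: "'i \<times> nat \<Rightarrow> ('i \<times> nat) cpoly" where
  "new = (\<lambda>(i, j). if j = 0 then new0 i else if j = 1 then new1 i
     else X (i, j) - C (p (i, j)) * new0 i - C (q (i, j)) * new1 i)"

lemma old_apply: "old (i, j) = C (p (i, j)) * X (i, 0) + C (q (i, j)) * X (i, 1)
     + (if j \<ge> 2 then X (i, j) else 0)"
  by (simp add: old_def)

lemma new_apply: "new (i, j) = (if j = 0 then new0 i else if j = 1 then new1 i
     else X (i, j) - C (p (i, j)) * new0 i - C (q (i, j)) * new1 i)"
  by (simp add: new_def)

text \<open>\<open>new0\<close> and \<open>new1\<close> invert a 2 by 2 system by Cramer's rule;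
  this identity of constant polynomials cancels its determinant.\<close>

lemma det_inverse:
  assumes "i \<in> I"
  shows "C (1 / det i) * (C (p (i, 0)) * C (q (i, 1)) - C (p (i, 1)) * C (q (i, 0))) = 1"
proof -
  have "C (1 / det i) * (C (p (i, 0)) * C (q (i, 1)) - C (p (i, 1)) * C (q (i, 0)))
      = C (1 / det i * det i)"
    by (simp only: det_def rhom.mult[OF C_rhom] rhom.minus[OF C_rhom])
  then show ?thesis using minor[OF assms] by (simp add: det_def)
qed

lemma old_forms: "v \<in> mvars I n \<Longrightarrow> old v \<in> forms I n (unit_deg (fst v))"
  using n_pos by (fastforce simp: mvars_def old_def intro!: forms_add forms_C_mult X_forms forms_zero)

lemma new01_forms:
  assumes "i \<in> I"
  shows "new0 i \<in> forms I n (unit_deg i)" "new1 i \<in> forms I n (unit_deg i)"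
  unfolding new0_def new1_def using n_pos[OF assms] assms
  by (intro forms_diff forms_C_mult X_forms; simp)+

lemma new_forms: "v \<in> mvars I n \<Longrightarrow> new v \<in> forms I n (unit_deg (fst v))"
  by (auto simp: mvars_def new_def intro!: forms_diff forms_C_mult X_forms new01_forms)

abbreviation "to_new \<equiv> poly_val C old"
abbreviation "to_old \<equiv> poly_val C new"

lemma to_old_old:
  assumes "i \<in> I"
  shows "to_old (old (i, j)) = X (i, j)"
proof -
  interpret rhom to_old by (rule poly_val_rhom[OF C_rhom])
  have eq: "to_old (old (i, j)) = C (p (i, j)) * new0 i + C (q (i, j)) * new1 i
     + (if j \<ge> 2 then new (i, j) else 0)"
    by (simp add: old_apply add mult zero poly_val_C[OF C_rhom] poly_val_X[OF C_rhom])
      (simp add: new_apply)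
  consider "j = 0" | "j = 1" | "j \<ge> 2" by linarith
  then show ?thesis
  proof cases
    case 1
    have "to_old (old (i, j)) = C (1 / det i) * (C (p (i, 0)) * C (q (i, 1)) - C (p (i, 1)) * C (q (i, 0))) * X (i, 0)"
      unfolding eq using 1 by (simp add: new0_def new1_def algebra_simps)
    then show ?thesis using 1 by (simp only: det_inverse[OF assms] mult_1_left)
  next
    case 2
    have "to_old (old (i, j)) = C (1 / det i) * (C (p (i, 0)) * C (q (i, 1)) - C (p (i, 1)) * C (q (i, 0))) * X (i, 1)"
      unfolding eq using 2 by (simp add: new0_def new1_def algebra_simps)
    then show ?thesis using 2 by (simp only: det_inverse[OF assms] mult_1_left)
  next
    case 3
    then show ?thesis by (simp add: eq new_apply)
  qed
qed

lemma to_new_new: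
  assumes "i \<in> I"
  shows "to_new (new (i, j)) = X (i, j)"
proof -
  interpret rhom to_new by (rule poly_val_rhom[OF C_rhom])
  note simps = add mult minus zero poly_val_C[OF C_rhom] poly_val_X[OF C_rhom]
  have "to_new (new0 i) = C (1 / det i) * (C (p (i, 0)) * C (q (i, 1)) - C (p (i, 1)) * C (q (i, 0))) * X (i, 0)"
    by (simp add: new0_def simps old_apply algebra_simps)
  then have 0: "to_new (new0 i) = X (i, 0)"
    by (simp only: det_inverse[OF assms] mult_1_left)
  have "to_new (new1 i) = C (1 / det i) * (C (p (i, 0)) * C (q (i, 1)) - C (p (i, 1)) * C (q (i, 0))) * X (i, 1)"
    by (simp add: new1_def simps old_apply algebra_simps)
  then have 1: "to_new (new1 i) = X (i, 1)"
    by (simp only: det_inverse[OF assms] mult_1_left)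
  show ?thesis
    by (simp add: new_apply 0 1 simps) (simp add: old_apply)
qed

text \<open>The composite substitution fixes the variables over \<open>I\<close>, and a form
  contains no others.\<close>

lemma to_old_to_new:
  assumes "F \<in> forms I n d"
  shows "to_old (to_new F) = F"
proof -
  have "to_old (to_new F) = poly_val C (\<lambda>v. to_old (old v)) F"
    by (simp add: rhom.poly_val[OF poly_val_rhom[OF C_rhom]] poly_val_C[OF C_rhom])
  also have "\<dots> = poly_val C X F"
    using assms by (intro poly_val_cong) (force simp: forms_iff mons_def mvars_def to_old_old)
  finally show ?thesis by (simp add: poly_val_C_X)
qed

lemma to_new_to_old:
  assumes "F \<in> forms I n d"
  shows "to_new (to_old F) = F"
proof -
  have "to_new (to_old F) = poly_val C (\<lambda>v. to_new (new v)) F"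
    by (simp add: rhom.poly_val[OF poly_val_rhom[OF C_rhom]] poly_val_C[OF C_rhom])
  also have "\<dots> = poly_val C X F"
    using assms by (intro poly_val_cong) (force simp: forms_iff mons_def mvars_def to_new_new)
  finally show ?thesis by (simp add: poly_val_C_X)
qed

text \<open>In the new coordinates \<open>p\<close> and \<open>q\<close> are the coordinate points
  of index 0 and 1, so the new coordinates of any other index lie in the respective point
  ideal.\<close>

lemma eval_new:
  assumes "i \<in> I"
  shows "eval_poly (new (i, j)) p = (if j = 0 then 1 else 0)"
    "eval_poly (new (i, j)) q = (if j = 1 then 1 else 0)"
proof -
  have *: "eval_poly (C c) x = c" "eval_poly (X v) x = x v" for c v and x :: "'i \<times> nat \<Rightarrow> complex"
    by (simp_all add: eval_poly_eq poly_val_C[OF id_rhom] poly_val_X[OF id_rhom])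
  note simps = rhom.minus[OF eval_rhom] rhom.mult[OF eval_rhom] *
  have det: "det i \<noteq> 0" using minor[OF assms] by (simp add: det_def)
  have "eval_poly (new0 i) p = det i / det i" "eval_poly (new1 i) p = 0"
    "eval_poly (new0 i) q = 0" "eval_poly (new1 i) q = det i / det i"
    by (simp_all add: new0_def new1_def simps) (simp_all add: det_def mult.commute)
  then show "eval_poly (new (i, j)) p = (if j = 0 then 1 else 0)"
    "eval_poly (new (i, j)) q = (if j = 1 then 1 else 0)"
    using det by (simp_all add: new_apply simps)
qed

text \<open>A linear change of coordinates carries lines to lines: \<open>x\<close> is the point
  with new coordinates \<open>y\<close>, and \<open>u\<close> is the image of the direction
  \<open>U\<close>, the same for all \<open>F\<close>.\<close>

lemma line_to_new:
  assumes "\<And>i j. x (i, j) = p (i, j) * y (i, 0) + q (i, j) * y (i, 1) + (if j \<ge> 2 then y (i, j) else 0)"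
  obtains u where "\<And>F. line y U (to_new F) = line x u F"
proof
  interpret rhom "line y U" by (rule line_rhom)
  let ?u = "\<lambda>(i, j). p (i, j) * U (i, 0) + q (i, j) * U (i, 1) + (if j \<ge> 2 then U (i, j) else 0)"
  have C: "line y U (C c) = [:c:]" and X: "line y U (X v) = [:y v, U v:]" for c v
    by (simp_all add: line_def poly_val_C[OF const_poly_rhom] poly_val_X[OF const_poly_rhom])
  have "line y U (old v) = [:x v, ?u v:]" for v
    by (cases v) (simp add: old_apply assms add mult zero C X)
  then show "line y U (to_new F) = line x ?u F" for F
    by (simp add: poly_val C line_def[of x])
qed

lemma mon_val_new_ideal_square:
  assumes m: "m \<in> mons I n d" "m \<notin> jet_mons I n d c"
    and r: "\<And>v. v \<in> mvars I n \<Longrightarrow> snd v \<noteq> c \<Longrightarrow> eval_poly (new v) r = 0"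
  shows "mon_val new m \<in> ideal_square I n (point_ideal I n r)"
proof -
  from not_jet_mons_split[OF m] obtain v w m' where
    split: "m = single v 1 + (single w 1 + m')" and vw: "v \<in> mvars I n" "w \<in> mvars I n"
    "snd v \<noteq> c" "snd w \<noteq> c" and m': "keys m' \<subseteq> mvars I n" .
  have new_ideal: "new u \<in> point_ideal I n r" if "u \<in> mvars I n" "snd u \<noteq> c" for u
    unfolding point_ideal_def using that new_forms r by (intro ideal_gen_gen) blast
  have "m' \<in> mons I n (\<lambda>i. \<Sum>j\<le>n i. lookup m' (i, j))"
    using m' by (simp add: mons_def)
  then have 1: "mon_val new m' \<in> coord_ring I n"
    by (intro forms_coord_ring mon_val_forms new_forms)
  have 2: "new v * new w \<in> ideal_square I n (point_ideal I n r)"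
    unfolding ideal_square_def using new_ideal vw by (intro ideal_gen_gen) blast
  have "mon_val new m = mon_val new m' * (new v * new w)"
    by (simp add: split mon_val_add mult_ac)
  with ideal_gen_mult[OF 2[unfolded ideal_square_def] 1] show ?thesis
    by (simp only: ideal_square_def)
qed

text \<open>The inclusion from left to right reads off coefficients along lines through \<open>p\<close> and \<open>q\<close>; for
  the other one no localization is needed, as the forms already lie in the squared ideals.\<close>

lemma ideal_sections_eq:
  assumes J: "J = {F \<in> coord_ring I n. F \<in> ideal_square I n (point_ideal I n p) \<and>
    F \<in> ideal_square I n (point_ideal I n q)}"
  shows "ideal_sections I n J d =
    to_old ` {F. keys F \<subseteq> mons I n d - (jet_mons I n d 0 \<union> jet_mons I n d 1)}" (is "_ = to_old ` ?S")
proof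
  have "p (i, 0) \<noteq> 0 \<or> p (i, 1) \<noteq> 0" "q (i, 0) \<noteq> 0 \<or> q (i, 1) \<noteq> 0" if "i \<in> I" for i
    using minor[OF that] by auto
  then have pts: "p \<in> points I n" "q \<in> points I n"
    unfolding points_def using n_pos by (blast intro: le0)+
  have J': "J \<subseteq> ideal_square I n (point_ideal I n p)" "J \<subseteq> ideal_square I n (point_ideal I n q)"
    by (auto simp: J)
  show "ideal_sections I n J d \<subseteq> to_old ` ?S"
  proof
    fix F assume F: "F \<in> ideal_sections I n J d"
    then have Fd: "F \<in> forms I n d" by (simp add: ideal_sections_def)
    then have G: "to_new F \<in> forms I n d" by (intro poly_val_forms old_forms)
    \<comment> \<open>Applied with \<open>c = 0\<close>, \<open>r = p\<close> and with
      \<open>c = 1\<close>, \<open>r = q\<close>; the last assumption says that \<open>r\<close> has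
      new coordinates \<open>corner c\<close>.\<close>
    have "lookup (to_new F) m = 0" if m: "m \<in> jet_mons I n d c" and r: "r \<in> points I n"
        "J \<subseteq> ideal_square I n (point_ideal I n r)"
      and x: "\<And>i j. r (i, j) = p (i, j) * corner c (i, 0) + q (i, j) * corner c (i, 1)
          + (if j \<ge> 2 then corner c (i, j) else 0)" for m c r
    proof -
      from jet_mons_support[OF m I_nonempty n_pos] obtain v where
        v: "snd v \<noteq> c" "lookup m v \<le> 1" "\<And>w. w \<in> keys m \<Longrightarrow> snd w \<noteq> c \<Longrightarrow> w = v" by blast
      from line_to_new[OF x] obtain u where
        u: "line (corner c) (dir v) (to_new F) = line r u F" by blast
      have "lookup (to_new F) m = coeff (line (corner c) (dir v) (to_new F)) (lookup m v)"
        using m v by (intro coeff_line_corner[OF G, symmetric]) (auto simp: jet_mons_def)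
      also have "\<dots> = 0"
        unfolding u using v(2) by (intro ideal_sections_line[OF F r(2,1)]) auto
      finally show ?thesis .
    qed
    from this[of _ 0 p] this[of _ 1 q] pts J' G have "to_new F \<in> ?S"
      by (auto simp: forms_iff in_keys_iff)
    then show "F \<in> to_old ` ?S" by (rule image_eqI[rotated]) (simp only: to_old_to_new[OF Fd])
  qed
  show "to_old ` ?S \<subseteq> ideal_sections I n J d"
  proof
    fix F assume "F \<in> to_old ` ?S"
    then obtain G where G: "G \<in> ?S" "F = to_old G" by blast
    then have Fd: "F \<in> forms I n d"
      unfolding G(2) by (intro poly_val_forms new_forms) (auto simp: forms_iff)
    have sq: "F \<in> ideal_square I n (point_ideal I n r)"
      if "\<And>v. v \<in> mvars I n \<Longrightarrow> snd v \<noteq> c \<Longrightarrow> eval_poly (new v) r = 0" "c = 0 \<or> c = 1" for r c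
    proof -
      have mon: "mon_val new m \<in> ideal_square I n (point_ideal I n r)" if "m \<in> keys G" for m
        using G(1) that \<open>c = 0 \<or> c = 1\<close>
        by (intro mon_val_new_ideal_square[of m d c] \<open>\<And>v. v \<in> mvars I n \<Longrightarrow> snd v \<noteq> c \<Longrightarrow> eval_poly (new v) r = 0\<close>) auto
      show ?thesis
        unfolding G(2) poly_val_def ideal_square_def
        using mon[unfolded ideal_square_def]
        by (intro ideal_gen_sum ideal_gen_mult forms_coord_ring[OF forms_C])
    qed
    have "F \<in> J"
      using sq[of 0 p] sq[of 1 q] forms_coord_ring[OF Fd] by (auto simp: J mvars_def eval_new)
    moreover have "1 \<in> (\<Union>d. forms I n d)" using forms_one by blast
    moreover have "eval_poly 1 r \<noteq> 0" for r :: "'i \<times> nat \<Rightarrow> complex"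
      by (simp add: rhom.one[OF eval_rhom])
    ultimately show "F \<in> ideal_sections I n J d"
      unfolding ideal_sections_def using Fd
      by (intro CollectI conjI ballI bexI[of _ 1]) simp_all
  qed
qed

end

section \<open>Counting monomials\<close>

lemma finite_mvars: "finite I \<Longrightarrow> finite (mvars I n)"
  by (simp add: mvars_def)

lemma lookup_mons_outside: "m \<in> mons I n d \<Longrightarrow> v \<notin> mvars I n \<Longrightarrow> lookup m v = 0"
  unfolding mons_def by (auto simp: in_keys_iff)

text \<open>The exponents on each factor form a list of fixed length and sum. This gives finiteness,
  and the stars-and-bars count of such lists gives the binomial product.\<close>

lemma bij_betw_mons:
  assumes I: "finite I"
  shows "bij_betw (\<lambda>m. \<lambda>i\<in>I. map (\<lambda>j. lookup m (i, j)) [0..<Suc (n i)]) (mons I n d)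
    (\<Pi>\<^sub>E i\<in>I. {l. length l = Suc (n i) \<and> sum_list l = d i})"
proof (rule bij_betw_byWitness[where f' =
      "\<lambda>L. Abs_poly_mapping (\<lambda>(i, j). if i \<in> I \<and> j \<le> n i then L i ! j else 0)"])
  let ?f = "\<lambda>m. \<lambda>i\<in>I. map (\<lambda>j. lookup m (i, j)) [0..<Suc (n i)]"
  let ?h = "\<lambda>L (i, j). if i \<in> I \<and> j \<le> n i then L i ! j else (0::nat)"
  let ?P = "\<Pi>\<^sub>E i\<in>I. {l. length l = Suc (n i) \<and> sum_list l = d i}"
  have lk: "lookup (Abs_poly_mapping (?h L)) = ?h L" for L
    by (rule lookup_Abs_poly_mapping, rule finite_subset[OF _ finite_mvars[OF I, of n]])
      (auto simp: mvars_def split: if_splits)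
  have sum: "sum_list (map g [0..<Suc k]) = (\<Sum>j\<le>k. g j)" for g :: "nat \<Rightarrow> nat" and k
    by (simp only: interv_sum_list_conv_sum_set_nat atLeast_upt[symmetric] atLeast0LessThan
        lessThan_Suc_atMost)
  show "\<forall>m\<in>mons I n d. Abs_poly_mapping (?h (?f m)) = m"
  proof
    fix m assume m: "m \<in> mons I n d"
    show "Abs_poly_mapping (?h (?f m)) = m"
    proof (rule poly_mapping_eqI)
      fix v :: "'a \<times> nat"
      obtain i j where v: "v = (i, j)" by (cases v)
      show "lookup (Abs_poly_mapping (?h (?f m))) v = lookup m v"
        unfolding lk v using lookup_mons_outside[OF m, of "(i, j)"]
        by (cases "i \<in> I \<and> j \<le> n i") (auto simp: mvars_def simp del: upt_Suc)
    qed
  qed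
  show "\<forall>L\<in>?P. ?f (Abs_poly_mapping (?h L)) = L"
  proof
    fix L assume L: "L \<in> ?P"
    have in_I: "map (\<lambda>j. ?h L (i, j)) [0..<Suc (n i)] = L i" if "i \<in> I" for i
      using PiE_mem[OF L that] that by (intro nth_equalityI) (auto simp del: upt_Suc)
    show "?f (Abs_poly_mapping (?h L)) = L"
    proof (rule ext)
      fix i
      show "?f (Abs_poly_mapping (?h L)) i = L i"
      proof (cases "i \<in> I")
        case True
        then show ?thesis by (simp only: restrict_apply' lk in_I)
      next
        case False
        then show ?thesis by (simp only: restrict_apply if_False PiE_arb[OF L False])
      qed
    qed
  qed
  show "?f ` mons I n d \<subseteq> ?P"
    by (auto simp: mons_def sum simp del: upt_Suc)
  show "(\<lambda>L. Abs_poly_mapping (?h L)) ` ?P \<subseteq> mons I n d"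
  proof clarify
    fix L assume L: "L \<in> ?P"
    have "keys (Abs_poly_mapping (?h L)) \<subseteq> mvars I n"
      by (auto simp: in_keys_iff lk mvars_def split: if_splits)
    moreover have "\<forall>i\<in>I. (\<Sum>j\<le>n i. ?h L (i, j)) = d i"
    proof
      fix i assume that: "i \<in> I"
      have "(\<Sum>j\<le>n i. ?h L (i, j)) = (\<Sum>j<length (L i). L i ! j)"
        using PiE_mem[OF L that] that by (intro sum.cong) auto
      also have "\<dots> = sum_list (L i)"
        by (simp only: sum_list_sum_nth atLeast0LessThan)
      also have "\<dots> = d i"
        using PiE_mem[OF L that] by simp
      finally show "(\<Sum>j\<le>n i. ?h L (i, j)) = d i" .
    qed
    ultimately show "Abs_poly_mapping (?h L) \<in> mons I n d"
      unfolding mons_def by (simp only: mem_Collect_eq lk)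
  qed
qed

lemma finite_lists_sum: "finite {l::nat list. length l = k \<and> sum_list l = s}"
proof (rule finite_subset)
  show "{l::nat list. length l = k \<and> sum_list l = s} \<subseteq> {l. set l \<subseteq> {..s} \<and> length l = k}"
    using member_le_sum_list by fastforce
qed (rule finite_lists_length_eq, simp)

lemma finite_mons: "finite I \<Longrightarrow> finite (mons I n d)"
  using bij_betw_finite[OF bij_betw_mons[of I n d]] by (simp add: finite_PiE finite_lists_sum)

lemma card_mons: "finite I \<Longrightarrow> card (mons I n d) = (\<Prod>i\<in>I. (n i + d i) choose d i)"
  using bij_betw_same_card[OF bij_betw_mons[of I n d]]
  by (simp add: card_PiE card_length_sum_list add.commute)

lemma sum_mons:
  assumes "finite I" "m \<in> mons I n d"
  shows "(\<Sum>v\<in>keys m. lookup m v) = (\<Sum>i\<in>I. d i)"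
proof -
  have "(\<Sum>v\<in>keys m. lookup m v) = (\<Sum>v\<in>mvars I n. lookup m v)"
    using assms finite_mvars by (intro sum.mono_neutral_left) (auto simp: mons_def in_keys_iff)
  also have "\<dots> = (\<Sum>i\<in>I. \<Sum>j\<le>n i. lookup m (i, j))"
    using assms(1) by (simp add: mvars_def sum.Sigma)
  also have "\<dots> = (\<Sum>i\<in>I. d i)"
    using assms(2) by (simp add: mons_def)
  finally show ?thesis .
qed

section \<open>Enumeration of the monomials in a 1-jet\<close>

context
  fixes I :: "'i set" and n d :: "'i \<Rightarrow> nat" and c :: nat
  assumes I: "finite I" "I \<noteq> {}" and c: "\<And>i. i \<in> I \<Longrightarrow> c \<le> n i"
    and n: "\<And>i. i \<in> I \<Longrightarrow> n i \<ge> 1" and d: "\<And>i. i \<in> I \<Longrightarrow> d i \<ge> 1"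
begin

definition base_mon :: "'i \<times> nat \<Rightarrow>\<^sub>0 nat" where
  "base_mon = (\<Sum>i\<in>I. single (i, c) (d i))"

text \<open>One factor \<open>(fst v, c)\<close> of the base monomial is exchanged for
  \<open>v\<close>. For \<open>v\<close> in \<open>mvars I n\<close> the subtraction does not
  truncate, as \<open>d\<close> is at least 1 on \<open>I\<close>.\<close>

definition jet_mon :: "'i \<times> nat \<Rightarrow> 'i \<times> nat \<Rightarrow>\<^sub>0 nat" where
  "jet_mon v = base_mon - single (fst v, c) 1 + single v 1"

lemma lookup_base_mon: "lookup base_mon (i, j) = (if i \<in> I \<and> j = c then d i else 0)"
proof -
  have "lookup base_mon (i, j) = (\<Sum>i'\<in>I. if i' = i then if j = c then d i else 0 else 0)"
    unfolding base_mon_def lookup_sum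
    by (intro sum.cong) (auto simp: lookup_single when_def)
  then show ?thesis using I(1) by simp
qed

lemma lookup_jet_mon: "lookup (jet_mon v) (i, j) =
    (if i \<in> I \<and> j = c then d i - (if i = fst v then 1 else 0) else 0) + (if v = (i, j) then 1 else 0)"
  by (auto simp: jet_mon_def lookup_add lookup_minus lookup_base_mon lookup_single when_def)

lemma base_mon_jet: "base_mon \<in> jet_mons I n d c"
proof -
  have "base_mon \<in> mons I n d"
    using c by (auto simp: mons_def mvars_def in_keys_iff lookup_base_mon split: if_splits)
  moreover have "(\<Sum>v\<in>{v \<in> keys base_mon. snd v \<noteq> c}. lookup base_mon v) = 0"
    by (auto simp: lookup_base_mon)
  ultimately show ?thesis by (simp add: jet_mons_def del: sum_eq_0_iff)
qed

lemma jet_mon_jet: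
  assumes v: "v \<in> mvars I n" "snd v \<noteq> c"
  shows "jet_mon v \<in> jet_mons I n d c"
proof -
  have "(\<Sum>j\<le>n i. lookup (jet_mon v) (i, j)) = d i" if "i \<in> I" for i
  proof -
    have "(\<Sum>j\<le>n i. lookup (jet_mon v) (i, j)) =
        (\<Sum>j\<le>n i. if j = c then d i - (if i = fst v then 1 else 0) else 0) +
        (\<Sum>j\<le>n i. if j = snd v then (if i = fst v then 1 else 0) else 0)"
      unfolding sum.distrib[symmetric] using that
      by (intro sum.cong) (auto simp: lookup_jet_mon)
    also have "\<dots> = d i"
      using c[OF that] d[OF that] v by (auto simp: mvars_def)
    finally show ?thesis .
  qed
  moreover have "keys (jet_mon v) \<subseteq> mvars I n"
    using v c by (auto simp: in_keys_iff lookup_jet_mon mvars_def split: if_splits)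
  moreover have "(\<Sum>w\<in>{w \<in> keys (jet_mon v). snd w \<noteq> c}. lookup (jet_mon v) w)
      = (\<Sum>w\<in>{w \<in> keys (jet_mon v). snd w \<noteq> c}. if w = v then 1 else 0)"
    by (intro sum.cong) (auto simp: lookup_jet_mon)
  ultimately show ?thesis by (simp add: jet_mons_def mons_def)
qed

text \<open>By \<open>jet_mons_support\<close>, at most one variable of index other than
  \<open>c\<close> occurs, with exponent at most 1. Exponent 0 forces the base monomial and exponent
  1 forces \<open>jet_mon v\<close>, by \<open>mons_eqI\<close>.\<close>

lemma jet_mons_eq: "jet_mons I n d c = insert base_mon (jet_mon ` {v \<in> mvars I n. snd v \<noteq> c})"
proof
  show "insert base_mon (jet_mon ` {v \<in> mvars I n. snd v \<noteq> c}) \<subseteq> jet_mons I n d c"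
    using base_mon_jet jet_mon_jet by auto
  show "jet_mons I n d c \<subseteq> insert base_mon (jet_mon ` {v \<in> mvars I n. snd v \<noteq> c})"
  proof
    fix m assume m: "m \<in> jet_mons I n d c"
    then have mm: "m \<in> mons I n d" by (simp add: jet_mons_def)
    obtain v where v: "snd v \<noteq> c" "lookup m v \<le> 1" "\<And>w. w \<in> keys m \<Longrightarrow> snd w \<noteq> c \<Longrightarrow> w = v"
      using jet_mons_support[OF m I(2) n] by blast
    have eq: "m = m'" if "m' \<in> jet_mons I n d c" "lookup m v = lookup m' v"
      "\<And>w. snd w \<noteq> c \<Longrightarrow> w \<noteq> v \<Longrightarrow> lookup m' w = 0" for m'
    proof (rule mons_eqI[OF mm v(3) _ _ v(1) that(2)])
      show "m' \<in> mons I n d" using that(1) by (simp add: jet_mons_def)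
      show "w = v" if "w \<in> keys m'" "snd w \<noteq> c" for w
        using that \<open>\<And>w. snd w \<noteq> c \<Longrightarrow> w \<noteq> v \<Longrightarrow> lookup m' w = 0\<close>[of w]
        by (auto simp: in_keys_iff)
    qed
    consider "lookup m v = 0" | "lookup m v = 1" using v(2) by linarith
    then show "m \<in> insert base_mon (jet_mon ` {v \<in> mvars I n. snd v \<noteq> c})"
    proof cases
      case 1
      have "lookup base_mon w = 0" if "snd w \<noteq> c" for w
        using that by (cases w) (simp add: lookup_base_mon)
      then have "m = base_mon" using 1 v(1) by (intro eq base_mon_jet) auto
      then show ?thesis by simp
    next
      case 2
      then have mv: "v \<in> mvars I n" using lookup_mons_outside[OF mm, of v] by fastforce
      have "lookup (jet_mon v) w = (if w = v then 1 else 0)" if "snd w \<noteq> c" for w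
        using that by (cases w) (auto simp: lookup_jet_mon)
      then have "m = jet_mon v" using 2 v(1) by (intro eq jet_mon_jet mv) auto
      then show ?thesis using mv v(1) by blast
    qed
  qed
qed

text \<open>The number of conditions expected of a double point: one for the value and one for each
  first derivative, with \<open>n i\<close> directions on factor \<open>i\<close>.\<close>

lemma card_jet_mons: "card (jet_mons I n d c) = 1 + (\<Sum>i\<in>I. n i)"
proof -
  let ?V = "{v \<in> mvars I n. snd v \<noteq> c}"
  have lk: "lookup (jet_mon v) w = (if w = v then 1 else 0)" if "snd w \<noteq> c" for v w
    using that by (cases w) (auto simp: lookup_jet_mon)
  have "inj_on jet_mon ?V"
  proof (rule inj_onI)
    fix v w assume vw: "v \<in> ?V" "w \<in> ?V" "jet_mon v = jet_mon w"
    have "(if w = v then 1 else 0) = lookup (jet_mon w) w"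
      using lk[of w v] vw by simp
    also have "\<dots> = 1"
      using lk[of w w] vw(2) by simp
    finally show "v = w" by presburger
  qed
  then have "card (jet_mon ` ?V) = card ?V" by (rule card_image)
  also have "\<dots> = card (SIGMA i:I. {..n i} - {c})"
    by (rule arg_cong[of _ _ card]) (auto simp: mvars_def)
  also have "\<dots> = (\<Sum>i\<in>I. n i)"
    using I c by (simp add: card_Diff_subset)
  finally have "card (jet_mon ` ?V) = (\<Sum>i\<in>I. n i)" .
  moreover have "base_mon \<notin> jet_mon ` ?V"
  proof
    assume "base_mon \<in> jet_mon ` ?V"
    then obtain v where v: "v \<in> ?V" "base_mon = jet_mon v" by blast
    then show False using lk[of v v] lookup_base_mon[of "fst v" "snd v"] by simp
  qed
  moreover have "finite ?V" using I(1) by (simp add: finite_mvars)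
  ultimately show ?thesis by (simp add: jet_mons_eq)
qed

end

text \<open>At most one unit of degree lies off index 0 and at most one off index 1. Adding these
  bounds counts variables of index 0 or 1 once and all others twice.\<close>

lemma jet_mons_Int:
  assumes I: "finite I" and m: "m \<in> jet_mons I n d 0 \<inter> jet_mons I n d 1"
  shows "(\<Sum>i\<in>I. d i) + (\<Sum>v\<in>{v \<in> keys m. snd v \<ge> 2}. lookup m v) \<le> 2"
proof -
  let ?s = "\<lambda>P. \<Sum>v\<in>{v \<in> keys m. P (snd v)}. lookup m v"
  have split: "?s P = ?s (\<lambda>j. P j \<and> Q j) + ?s (\<lambda>j. P j \<and> \<not> Q j)" for P Q
    by (subst sum.union_disjoint[symmetric]) (auto intro!: sum.cong)
  have le: "?s (\<lambda>j. j \<noteq> 0) \<le> 1" "?s (\<lambda>j. j \<noteq> 1) \<le> 1"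
    using m by (auto simp: jet_mons_def)
  have "?s (\<lambda>j. True) = (\<Sum>i\<in>I. d i)"
    using sum_mons[OF I, of m n d] m by (simp add: jet_mons_def)
  moreover have "?s (\<lambda>j. True) = ?s (\<lambda>j. j \<noteq> 0) + ?s (\<lambda>j. j = 0)"
    using split[of "\<lambda>_. True" "\<lambda>j. j \<noteq> 0"] by simp
  moreover have "(j \<noteq> 1 \<and> j = 0) = (j = 0)" "(j \<noteq> 1 \<and> j \<noteq> 0) = (j \<ge> 2)" for j :: nat by auto
  then have "?s (\<lambda>j. j \<noteq> 1) = ?s (\<lambda>j. j = 0) + ?s (\<lambda>j. j \<ge> 2)"
    using split[of "\<lambda>j. j \<noteq> 1" "\<lambda>j. j = 0"] by simp
  ultimately show ?thesis using le by linarith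
qed

section \<open>The Hilbert function of two general double points\<close>

text \<open>In the new coordinates the sections are spanned by the monomials outside both jet sets,
  so their codimension is the size of the union.\<close>

lemma (in two_points) hilb_eq:
  assumes J: "J = {F \<in> coord_ring I n. F \<in> ideal_square I n (point_ideal I n p) \<and>
    F \<in> ideal_square I n (point_ideal I n q)}"
  shows "hilb I n J d = card (jet_mons I n d 0 \<union> jet_mons I n d 1)"
proof -
  let ?M = "mons I n d" and ?A = "jet_mons I n d 0 \<union> jet_mons I n d 1"
  have fin: "finite ?M" by (rule finite_mons[OF finite_I])
  have forms: "forms I n d = poly_val C X ` {F. keys F \<subseteq> ?M}"
    by (auto simp: forms_iff poly_val_C_X)
  have "cpoly.dim (forms I n d) = card ?M"
    unfolding forms
    by (intro dim_image_singles fin linear_poly_val_C inj_onI) (simp add: poly_val_C_X)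
  moreover have "cpoly.dim (ideal_sections I n J d) = card (?M - ?A)"
    unfolding ideal_sections_eq[OF J]
  proof (intro dim_image_singles linear_poly_val_C)
    show "inj_on to_old {F. keys F \<subseteq> ?M - ?A}"
    proof (rule inj_on_inverseI)
      show "to_new (to_old F) = F" if "F \<in> {F. keys F \<subseteq> ?M - ?A}" for F
        using that by (intro to_new_to_old[of F d]) (auto simp: forms_iff)
    qed
  qed (use fin in simp)
  moreover have sub: "?A \<subseteq> ?M" by (auto simp: jet_mons_def)
  moreover have "card (?M - ?A) = card ?M - card ?A"
    by (rule card_Diff_subset[OF finite_subset[OF sub fin] sub])
  ultimately show ?thesis
    using card_mono[OF fin sub] unfolding hilb_def by linarith
qed

section \<open>Genericity\<close>

lemma common_nonzero:
  assumes "eval_poly F x \<noteq> 0" "eval_poly G y \<noteq> 0"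
  obtains z where "eval_poly F z \<noteq> 0" "eval_poly G z \<noteq> 0"
proof -
  let ?u = "\<lambda>v. y v - x v"
  \<comment> \<open>The line runs from \<open>x\<close> at parameter 0 to \<open>y\<close> at
    parameter 1.\<close>
  have "poly (line x ?u F) 0 \<noteq> 0" "poly (line x ?u G) 1 \<noteq> 0"
    using assms by (simp_all add: poly_line)
  then have "line x ?u F * line x ?u G \<noteq> 0" by force
  then have "finite {t. poly (line x ?u F * line x ?u G) t = 0}" by (rule poly_roots_finite)
  then obtain t where "poly (line x ?u F * line x ?u G) t \<noteq> 0"
    using ex_new_if_finite[OF infinite_UNIV_char_0] by blast
  then show thesis
    by (intro that[of "\<lambda>v. x v + t * ?u v"]) (auto simp: poly_line)
qed

text \<open>Where it does not vanish, all the minors required by \<open>two_points\<close> are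
  nonzero; this locus is the open set used to witness \<open>T\<close>.\<close>

definition minors_poly :: "nat \<Rightarrow> ((nat \<times> nat) \<times> nat) cpoly" where
  "minors_poly k =
    (\<Prod>i\<in>{1..k}. X ((1, i), 0) * X ((2, i), 1) - X ((1, i), 1) * X ((2, i), 0))"

lemma eval_minors_poly:
  "eval_poly (minors_poly k) P =
    (\<Prod>i\<in>{1..k}. P ((1, i), 0) * P ((2, i), 1) - P ((1, i), 1) * P ((2, i), 0))"
proof -
  have "eval_poly (X v) P = P v" for v
    by (simp add: eval_poly_eq poly_val_X[OF id_rhom])
  then show ?thesis
    by (simp add: minors_poly_def rhom.prod[OF eval_rhom] rhom.minus[OF eval_rhom]
        rhom.mult[OF eval_rhom])
qed

context
  fixes k :: nat and n :: "nat \<Rightarrow> nat"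
  assumes k: "k \<ge> 1" and n: "\<And>i. i \<in> {1..k} \<Longrightarrow> n i \<ge> 1"
begin

lemma minors_poly_forms: "\<exists>d. minors_poly k \<in> forms ({1..2} \<times> {1..k}) (\<lambda>(r, i). n i) d"
proof -
  let ?I = "{1..2::nat} \<times> {1..k}" and ?n = "\<lambda>(r, i). n i"
  have X: "X ((r, i), j) \<in> forms ?I ?n (unit_deg (r, i))" if "i \<in> {1..k}" "r \<in> {1, 2}" "j \<le> 1" for i r j
    using that n[OF that(1)] by (intro X_forms) auto
  have "X ((1, i), 0) * X ((2, i), 1) - X ((1, i), 1) * X ((2, i), 0)
      \<in> forms ?I ?n (\<lambda>i'. unit_deg (1, i) i' + unit_deg (2, i) i')" if "i \<in> {1..k}" for i
    using that by (intro forms_diff forms_mult X) auto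
  from forms_prod[OF this, of "{1..k}" "\<lambda>i. i"] show ?thesis
    unfolding minors_poly_def by blast
qed

lemma hilb_general:
  assumes "eval_poly (minors_poly k) P \<noteq> 0"
  shows "P \<in> points ({1..2} \<times> {1..k}) (\<lambda>(r, i). n i)"
    and "hilb {1..k} n (double_points_ideal {1..k} n {1..2} (\<lambda>r (i, j). P ((r, i), j))) a
      = card (jet_mons {1..k} n a 0 \<union> jet_mons {1..k} n a 1)"
proof -
  have minor: "P ((1, i), 0) * P ((2, i), 1) - P ((1, i), 1) * P ((2, i), 0) \<noteq> 0" if "i \<in> {1..k}" for i
    using assms that unfolding eval_minors_poly by simp
  have "\<exists>j\<le>n i. P ((r, i), j) \<noteq> 0" if "i \<in> {1..k}" "r \<in> {1..2}" for r i
  proof -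
    have "r = 1 \<or> r = 2" using that by auto
    then have "P ((r, i), 0) \<noteq> 0 \<or> P ((r, i), 1) \<noteq> 0" using minor[OF that(1)] by auto
    then show ?thesis using n[OF that(1)] by blast
  qed
  then show "P \<in> points ({1..2} \<times> {1..k}) (\<lambda>(r, i). n i)"
    by (auto simp: points_def)
  interpret two_points "{1..k}" n "\<lambda>(i, j). P ((1, i), j)" "\<lambda>(i, j). P ((2, i), j)"
    using k n minor by unfold_locales auto
  have "{1..2::nat} = {1, 2}" by auto
  then show "hilb {1..k} n (double_points_ideal {1..k} n {1..2} (\<lambda>r (i, j). P ((r, i), j))) a
      = card (jet_mons {1..k} n a 0 \<union> jet_mons {1..k} n a 1)"
    by (intro hilb_eq) (simp add: double_points_ideal_def)
qed

lemma T_2_iff: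
  "T k n a 2 \<longleftrightarrow> card (jet_mons {1..k} n a 0 \<union> jet_mons {1..k} n a 1) =
    min (2 * (1 + (\<Sum>i=1..k. n i))) (\<Prod>i=1..k. (n i + a i) choose a i)" (is "_ \<longleftrightarrow> ?card = ?e")
proof -
  let ?I = "{1..2::nat} \<times> {1..k}" and ?n = "\<lambda>(r::nat, i). n i"
  let ?G = "minors_poly k"
  \<comment> \<open>The pair of coordinate points of index 0 (copy \<open>r = 1\<close>) and 1 (copy
    \<open>r = 2\<close>) on every factor; all its minors equal 1.\<close>
  define y :: "(nat \<times> nat) \<times> nat \<Rightarrow> complex"
    where "y = (\<lambda>((r, i), j). if Suc j = r then 1 else 0)"
  have y: "eval_poly ?G y \<noteq> 0" by (simp add: eval_minors_poly y_def)
  show ?thesis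
  proof
    assume "T k n a 2"
    then obtain U where U: "zariski_open ?I ?n U" "U \<noteq> {}" and
      h: "\<And>P. P \<in> U \<Longrightarrow> hilb {1..k} n (double_points_ideal {1..k} n {1..2} (\<lambda>r (i, j). P ((r, i), j))) a = ?e"
      unfolding T_def by blast
    from U obtain E F x where E: "U = {P \<in> points ?I ?n. \<exists>F\<in>E. eval_poly F P \<noteq> 0}"
      "F \<in> E" "eval_poly F x \<noteq> 0"
      unfolding zariski_open_def by blast
    \<comment> \<open>\<open>z\<close> is so far only an assignment of coordinates; the nonzero
      minors make it a point, hence an element of \<open>U\<close>.\<close>
    from common_nonzero[OF E(3) y] obtain z where z: "eval_poly F z \<noteq> 0" "eval_poly ?G z \<noteq> 0" .
    with E hilb_general(1)[OF z(2)] have "z \<in> U" by blast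
    from h[OF this] hilb_general(2)[OF z(2)] show "?card = ?e" by simp
  next
    assume eq: "?card = ?e"
    let ?U = "{P \<in> points ?I ?n. \<exists>F\<in>{?G}. eval_poly F P \<noteq> 0}"
    have "zariski_open ?I ?n ?U"
      unfolding zariski_open_def using minors_poly_forms by (intro exI[of _ "{?G}"]) auto
    moreover have "y \<in> ?U" using y hilb_general(1)[OF y] by simp
    then have "?U \<noteq> {}" by blast
    moreover have "\<forall>P\<in>?U. hilb {1..k} n (double_points_ideal {1..k} n {1..2} (\<lambda>r (i, j). P ((r, i), j))) a = ?e"
      using hilb_general(2)[where a = a] eq by simp
    ultimately show "T k n a 2" unfolding T_def by blast
  qed
qed

text \<open>Both jet sets have \<open>s = 1 + sum n\<close> elements, so their union has
  \<open>2 s\<close> minus the size of their intersection. It equals the minimum of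
  \<open>2 s\<close> and the number of all monomials exactly if one of these two upper bounds is
  attained.\<close>

lemma T_2_iff_jet_mons:
  assumes a: "\<And>i. i \<in> {1..k} \<Longrightarrow> a i \<ge> 1"
  shows "T k n a 2 \<longleftrightarrow> jet_mons {1..k} n a 0 \<inter> jet_mons {1..k} n a 1 = {} \<or>
    mons {1..k} n a \<subseteq> jet_mons {1..k} n a 0 \<union> jet_mons {1..k} n a 1"
proof -
  let ?A = "jet_mons {1..k} n a 0" and ?B = "jet_mons {1..k} n a 1" and ?M = "mons {1..k} n a"
  let ?s = "1 + (\<Sum>i=1..k. n i)"
  have card: "card (jet_mons {1..k} n a c) = ?s" if "c \<le> 1" for c
    by (rule card_jet_mons) (use k n a that in \<open>auto intro: order_trans\<close>)
  have M: "finite ?M" "card ?M = (\<Prod>i=1..k. (n i + a i) choose a i)"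
    by (simp_all add: finite_mons card_mons)
  have sub: "?A \<union> ?B \<subseteq> ?M" by (auto simp: jet_mons_def)
  then have fin: "finite ?A" "finite ?B" using M(1) by (auto intro: finite_subset)
  have union: "card (?A \<union> ?B) + card (?A \<inter> ?B) = 2 * ?s"
    using card_Un_Int[OF fin] card[of 0] card[of 1] by simp
  have le: "card (?A \<union> ?B) \<le> card ?M" by (rule card_mono[OF M(1) sub])
  have int: "card (?A \<inter> ?B) = 0 \<longleftrightarrow> ?A \<inter> ?B = {}" using fin by simp
  have eq: "card (?A \<union> ?B) = card ?M \<longleftrightarrow> ?M \<subseteq> ?A \<union> ?B"
    using card_subset_eq[OF M(1) sub] sub by (metis equalityE subset_antisym)
  show ?thesis
    unfolding T_2_iff M(2)[symmetric] int[symmetric] eq[symmetric]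
    using union le by linarith
qed

end

section \<open>Comparing the two jet sets by total degree\<close>

lemma mons_cong: "(\<And>i. i \<in> I \<Longrightarrow> d i = d' i) \<Longrightarrow> mons I n d = mons I n d'"
  by (simp add: mons_def)

lemma single_mons:
  assumes "i \<in> I" "j \<le> n i"
  shows "single (i, j) 1 \<in> mons I n (unit_deg i)"
  using X_forms[of i I j n] assms by (simp add: forms_iff X_def)

text \<open>The factors \<open>i\<close> and \<open>i'\<close> may coincide, so multidegrees 2 and
  (1,1) are treated together. The monomial has one variable of index 0 and one of index 1, hence one
  off each corner.\<close>

lemma jet_mons_Int_nonempty:
  assumes "i \<in> I" "i' \<in> I" "n i' \<ge> 1" and d: "\<And>j. j \<in> I \<Longrightarrow> d j = unit_deg i j + unit_deg i' j"
  shows "jet_mons I n d 0 \<inter> jet_mons I n d 1 \<noteq> {}"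
proof -
  define m where "m = single (i, 0::nat) (1::nat) + single (i', 1) 1"
  have "m \<in> mons I n (\<lambda>j. unit_deg i j + unit_deg i' j)"
    unfolding m_def using assms(1-3) by (intro mons_add single_mons) auto
  also have "\<dots> = mons I n d"
    by (rule mons_cong) (simp only: d)
  finally have m: "m \<in> mons I n d" .
  have lk: "lookup m (j, b) = (if b = 0 \<and> j = i \<or> b = 1 \<and> j = i' then 1 else 0)" for j b
    by (auto simp: m_def lookup_add lookup_single when_def)
  have "{v \<in> keys m. snd v \<noteq> 0} = {(i', 1)}" "{v \<in> keys m. snd v \<noteq> 1} = {(i, 0)}"
    by (auto simp: in_keys_iff lk split: if_splits)
  then have "(\<Sum>v\<in>{v \<in> keys m. snd v \<noteq> 0}. lookup m v) \<le> 1"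
    "(\<Sum>v\<in>{v \<in> keys m. snd v \<noteq> 1}. lookup m v) \<le> 1"
    by (simp_all add: lk[of _ 0] lk[of _ "Suc 0"])
  with m show ?thesis unfolding jet_mons_def by blast
qed

text \<open>A monomial of degree 2 in variables of index 2 has its whole degree off both
  corners.\<close>

lemma jet_mons_Un_proper:
  assumes "finite I" "i \<in> I" "i' \<in> I" "n i \<ge> 2" "n i' \<ge> 2"
    and d: "\<And>j. j \<in> I \<Longrightarrow> d j = unit_deg i j + unit_deg i' j" "(\<Sum>j\<in>I. d j) = 2"
  shows "\<not> mons I n d \<subseteq> jet_mons I n d 0 \<union> jet_mons I n d 1"
proof -
  let ?m = "single (i, 2::nat) (1::nat) + single (i', 2) 1"
  have "?m \<in> mons I n (\<lambda>j. unit_deg i j + unit_deg i' j)"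
    using assms(2-5) by (intro mons_add single_mons) auto
  also have "\<dots> = mons I n d"
    by (rule mons_cong) (simp only: d)
  finally have m: "?m \<in> mons I n d" .
  have "keys ?m \<subseteq> {(i, 2), (i', 2)}"
    using keys_add[of "single (i, 2::nat) (1::nat)" "single (i', 2) 1"] by auto
  then have "{v \<in> keys ?m. snd v \<noteq> c} = keys ?m" if "c \<le> 1" for c
    using that by auto
  then have "?m \<notin> jet_mons I n d c" if "c \<le> 1" for c
    using sum_mons[OF assms(1) m] d(2) that by (simp add: jet_mons_def)
  from this[of 0] this[of 1] m show ?thesis by auto
qed

text \<open>All of the total degree except at most one unit sits on a single variable of index
  \<open>c\<close>.\<close>

lemma jet_monsI:
  assumes I: "finite I" and m: "m \<in> mons I n d" and le: "(\<Sum>i\<in>I. d i) \<le> 1 + lookup m (i, c)"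
  shows "m \<in> jet_mons I n d c"
proof -
  let ?S = "{v \<in> keys m. snd v \<noteq> c}"
  have "(\<Sum>v\<in>?S. lookup m v) + lookup m (i, c) = (\<Sum>v\<in>insert (i, c) ?S. lookup m v)"
    by simp
  also have "\<dots> \<le> (\<Sum>v\<in>insert (i, c) (keys m). lookup m v)"
    by (intro sum_mono2) auto
  also have "\<dots> = (\<Sum>i\<in>I. d i)"
    unfolding sum_mons[OF I m, symmetric] by (intro sum.mono_neutral_right) (auto simp: in_keys_iff)
  finally show ?thesis using m le by (simp add: jet_mons_def)
qed

text \<open>Positive entries with sum 2 are either 2 alone or (1,1). In the second case the
  permutation puts the two entries of \<open>n\<close> into increasing order.\<close>

lemma exception_iff:
  fixes n a :: "nat \<Rightarrow> nat"
  assumes k: "k \<ge> 1" and a: "\<And>i. i \<in> {1..k} \<Longrightarrow> a i \<ge> 1"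
  shows "(\<exists>\<sigma>. \<sigma> permutes {1..k} \<and>
        ((k = 1 \<and> n (\<sigma> 1) \<ge> 2 \<and> a (\<sigma> 1) = 2) \<or>
         (k = 2 \<and> 2 \<le> n (\<sigma> 1) \<and> n (\<sigma> 1) \<le> n (\<sigma> 2) \<and> a (\<sigma> 1) = 1 \<and> a (\<sigma> 2) = 1)))
    \<longleftrightarrow> (\<Sum>i=1..k. a i) = 2 \<and> (\<forall>i\<in>{1..k}. n i \<ge> 2)" (is "?L \<longleftrightarrow> ?R")
proof
  assume ?L
  then obtain \<sigma> where \<sigma>: "\<sigma> permutes {1..k}" and
    cases: "(k = 1 \<and> n (\<sigma> 1) \<ge> 2 \<and> a (\<sigma> 1) = 2) \<or>
         (k = 2 \<and> 2 \<le> n (\<sigma> 1) \<and> n (\<sigma> 1) \<le> n (\<sigma> 2) \<and> a (\<sigma> 1) = 1 \<and> a (\<sigma> 2) = 1)"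
    by blast
  have "(\<Sum>i=1..k. a (\<sigma> i)) = (\<Sum>i=1..k. a i)" "\<sigma> ` {1..k} = {1..k}"
    using sum.permute[OF \<sigma>, of a] permutes_image[OF \<sigma>] by (simp_all add: comp_def)
  moreover have "(\<Sum>i=1..k. a (\<sigma> i)) = 2"
    using cases by (auto simp: numeral_2_eq_2)
  moreover have "n (\<sigma> i) \<ge> 2" if "i \<in> {1..k}" for i
    using cases
  proof
    assume "k = 2 \<and> 2 \<le> n (\<sigma> 1) \<and> n (\<sigma> 1) \<le> n (\<sigma> 2) \<and> a (\<sigma> 1) = 1 \<and> a (\<sigma> 2) = 1"
    moreover from this that have "i = 1 \<or> i = 2" by auto
    ultimately show ?thesis by auto
  qed (use that in auto)
  then have "\<forall>i\<in>\<sigma> ` {1..k}. n i \<ge> 2" by blast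
  ultimately show ?R by simp
next
  assume R: ?R
  have "k = (\<Sum>i=1..k. 1)" by simp
  also have "\<dots> \<le> (\<Sum>i=1..k. a i)" using a by (intro sum_mono) auto
  finally consider "k = 1" | "k = 2" using k R by linarith
  then show ?L
  proof cases
    case 1
    with R show ?thesis by (intro exI[of _ id]) (simp add: permutes_id)
  next
    case 2
    then have "a 1 + a 2 = 2" using R by (simp add: numeral_2_eq_2)
    moreover have "a 1 \<ge> 1" "a 2 \<ge> 1" using a 2 by auto
    ultimately have a12: "a 1 = 1" "a 2 = 1" by linarith+
    have n12: "n 1 \<ge> 2" "n 2 \<ge> 2" using R 2 by auto
    show ?thesis
    proof (cases "n 1 \<le> n 2")
      case True
      with 2 a12 n12 show ?thesis by (intro exI[of _ id]) (simp add: permutes_id)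
    next
      case False
      have "transpose 1 2 permutes {1..k}" using 2 by (intro permutes_swap_id) auto
      with False 2 a12 n12 show ?thesis by (intro exI[of _ "transpose 1 2"]) simp
    qed
  qed
qed

theorem theorem4p2:
  fixes k :: nat and n a :: "nat \<Rightarrow> nat"
  assumes "k \<ge> 1"
    and "\<And>i. i \<in> {1..k} \<Longrightarrow> n i \<ge> 1"
    and "\<And>i. i \<in> {1..k} \<Longrightarrow> a i \<ge> 1"
  shows "T k n a 2 \<longleftrightarrow>
    \<not> (\<exists>\<sigma>. \<sigma> permutes {1..k} \<and>
        ((k = 1 \<and> n (\<sigma> 1) \<ge> 2 \<and> a (\<sigma> 1) = 2) \<or>
         (k = 2 \<and> 2 \<le> n (\<sigma> 1) \<and> n (\<sigma> 1) \<le> n (\<sigma> 2) \<and> a (\<sigma> 1) = 1 \<and> a (\<sigma> 2) = 1)))"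
proof -
  let ?A = "jet_mons {1..k} n a 0" and ?B = "jet_mons {1..k} n a 1" and ?M = "mons {1..k} n a"
  let ?d = "\<Sum>i=1..k. a i"
  have T_iff: "T k n a 2 \<longleftrightarrow> ?A \<inter> ?B = {} \<or> ?M \<subseteq> ?A \<union> ?B"
    by (rule T_2_iff_jet_mons) (fact assms)+
  consider "?d \<ge> 3" | "?d \<le> 1" | i where "?d = 2" "i \<in> {1..k}" "n i = 1"
    | "?d = 2" "\<And>i. i \<in> {1..k} \<Longrightarrow> n i \<ge> 2"
  proof (cases "?d = 2 \<and> (\<exists>i\<in>{1..k}. n i < 2)")
    case True
    then obtain i where "?d = 2" "i \<in> {1..k}" "n i < 2" by blast
    with assms(2)[of i] show thesis by (intro that(3)[of i]) auto
  next
    case False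
    then have "?d \<noteq> 2 \<or> (\<forall>i\<in>{1..k}. n i \<ge> 2)" by (auto simp: not_less)
    then consider "?d \<ge> 3" | "?d \<le> 1" | "?d = 2" "\<forall>i\<in>{1..k}. n i \<ge> 2" by linarith
    then show thesis using that(1,2,4) by cases blast+
  qed
  then have "T k n a 2 \<longleftrightarrow> \<not> (?d = 2 \<and> (\<forall>i\<in>{1..k}. n i \<ge> 2))"
  proof cases
    case 1
    then have "?A \<inter> ?B = {}" using jet_mons_Int[of "{1..k}" _ n a] by fastforce
    with 1 show ?thesis
      unfolding T_iff by simp
  next
    case 2
    \<comment> \<open>With total degree at most 1, the bound in \<open>jet_monsI\<close> holds
      whatever the exponent is.\<close>
    then have "?M \<subseteq> ?A"
      using jet_monsI[of "{1..k}" _ n a _ 0] by fastforce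
    with 2 show ?thesis
      unfolding T_iff by auto
  next
    case (3 i)
    \<comment> \<open>Factor \<open>i\<close> has only the coordinates of index 0 and 1, and its
      degree is positive, so one of them occurs in \<open>m\<close>; at most one further unit of
      degree remains.\<close>
    have "m \<in> ?A \<union> ?B" if m: "m \<in> ?M" for m
    proof -
      have "(\<Sum>j\<le>n i. lookup m (i, j)) = a i"
        using m 3(2) unfolding mons_def by blast
      then have "lookup m (i, 0) + lookup m (i, 1) = a i"
        by (simp add: 3(3))
      then have "?d \<le> 1 + lookup m (i, 0) \<or> ?d \<le> 1 + lookup m (i, 1)"
        using assms(3)[OF 3(2)] 3(1) by linarith
      then show ?thesis using jet_monsI[OF _ m, of i] by auto
    qed
    then have "?M \<subseteq> ?A \<union> ?B" by blast
    moreover have "\<not> (\<forall>i\<in>{1..k}. n i \<ge> 2)" using 3(2,3) by fastforce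
    ultimately show ?thesis
      unfolding T_iff by blast
  next
    case 4
    have "k = (\<Sum>i=1..k. 1)" by simp
    also have "\<dots> \<le> ?d" using assms(3) by (intro sum_mono) auto
    finally have k: "k = 1 \<or> k = 2" using 4(1) assms(1) by linarith
    \<comment> \<open>Factors 1 and \<open>k\<close> carry the whole multidegree; they coincide if
      \<open>k = 1\<close>, which gives degree 2 there.\<close>
    have d: "a j = unit_deg 1 j + unit_deg k j" if "j \<in> {1..k}" for j
      using k
    proof
      assume "k = 1"
      with 4(1) that show ?thesis by auto
    next
      assume k2: "k = 2"
      then have "a 1 + a 2 = 2" using 4(1) by (simp add: numeral_2_eq_2)
      moreover have "a 1 \<ge> 1" "a 2 \<ge> 1" using assms(3) k2 by auto
      moreover have "j = 1 \<or> j = 2" using that k2 by auto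
      ultimately show ?thesis using k2 by auto
    qed
    have "?A \<inter> ?B \<noteq> {}"
      by (rule jet_mons_Int_nonempty[of 1 _ k]) (use assms(1,2) d in auto)
    moreover have "\<not> ?M \<subseteq> ?A \<union> ?B"
      by (rule jet_mons_Un_proper[of _ 1 k]) (use assms(1) 4 d in auto)
    ultimately show ?thesis
      unfolding T_iff using 4 by blast
  qed
  also have "(?d = 2 \<and> (\<forall>i\<in>{1..k}. n i \<ge> 2)) \<longleftrightarrow> (\<exists>\<sigma>. \<sigma> permutes {1..k} \<and>
        ((k = 1 \<and> n (\<sigma> 1) \<ge> 2 \<and> a (\<sigma> 1) = 2) \<or>
         (k = 2 \<and> 2 \<le> n (\<sigma> 1) \<and> n (\<sigma> 1) \<le> n (\<sigma> 2) \<and> a (\<sigma> 1) = 1 \<and> a (\<sigma> 2) = 1)))"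
    by (rule exception_iff[symmetric]) (fact assms)+
  finally show ?thesis .
qed

end
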